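(* For every (proper) Young diagram $Y$, \[|S_Y(213)|\leq |S_Y(123)|\leq |S_Y(312)|.\]
   Context: Permutations $\tau\in S_k$ are written in one-line notation $(\tau(1)\tau(2)\ldots\tau(k))$. $Y(a_1,\ldots,a_n)$, with $a_1\ge a_2\ge\cdots\ge a_n\ge 1$, denotes the left-justified Young diagram whose $i$-th row from the top has $a_i$ cells. Cells are coordinatized from the bottom left corner: $(x,y)$ is the cell in column $x$ (from the left) and row $y$ (from the bottom). A Young diagram of size $n$ is proper if it has exactly $n$ rows and $n$ columns and contains the staircase $Y(n,n-1,\ldots,2,1)$; all Young diagrams are assumed proper. A transversal $T$ of $Y$ (written $T\in S_Y$) is a set of $n$ cells of $Y$ with exactly one in every row and every column; equivalently a permutation $\pi$ of $\{1,\ldots,n\}$ such that every cell $(x,\pi(x))$ lies in $Y$. $T$ contains the pattern $\tau\in S_k$ in $Y$ if there are columns $x_1<\cdots<x_k$ such that $(\pi(x_1),\ldots,\pi(x_k))$ is order-isomorphic to $\tau$ and the cell $(x_k,\min_j\pi(x_j))$ (column of the rightmost element, row of the smallest element) belongs to $Y$. $S_Y(\tau)$ is the set of transversals of $Y$ that do not contain $\tau$ in $Y$. *)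

theory Defs
  imports Main
begin

text \<open>
  A diagram is given by its list of row lengths, read from the top row to the bottom row.
  Cells \<open>(x, y)\<close> are numbered from 1, with columns counted from the left and rows counted from
  the \<^emph>\<open>bottom\<close>; row \<open>y\<close> from the bottom is therefore entry \<open>length Y - y\<close> of the list.
\<close>

definition young_diagram :: "nat list \<Rightarrow> bool" where
  "young_diagram Y \<longleftrightarrow> sorted_wrt (\<ge>) Y \<and> (\<forall>a\<in>set Y. a \<ge> 1)"

definition cells :: "nat list \<Rightarrow> (nat \<times> nat) set" where
  "cells Y = {(x, y). 1 \<le> y \<and> y \<le> length Y \<and> 1 \<le> x \<and> x \<le> Y ! (length Y - y)}"

definition staircase :: "nat \<Rightarrow> nat list" where
  "staircase n = rev [1..<Suc n]"

definition proper :: "nat list \<Rightarrow> bool" where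
  "proper Y \<longleftrightarrow> young_diagram Y \<and> fst ` cells Y = {1..length Y} \<and>
     cells (staircase (length Y)) \<subseteq> cells Y"

definition transversals :: "nat list \<Rightarrow> (nat \<times> nat) set set" where
  "transversals Y = {T. T \<subseteq> cells Y \<and> card T = length Y \<and>
     (\<forall>x\<in>{1..length Y}. \<exists>!y. (x, y) \<in> T) \<and>
     (\<forall>y\<in>{1..length Y}. \<exists>!x. (x, y) \<in> T)}"

text \<open>
  A pattern is a nonempty permutation in one-line notation. The columns and rows of an occurrence
  are \<open>xs\<close> and \<open>ys\<close>. Besides being order-isomorphic to the pattern, an occurrence must have its
  lower right corner (rightmost column, lowest row) inside the diagram.
\<close>

definition contains_in :: "nat list \<Rightarrow> (nat \<times> nat) set \<Rightarrow> nat list \<Rightarrow> bool" where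
  "contains_in Y T \<tau> \<longleftrightarrow> (\<exists>xs ys. length xs = length \<tau> \<and> length ys = length \<tau> \<and>
     sorted_wrt (<) xs \<and>
     (\<forall>i<length \<tau>. (xs ! i, ys ! i) \<in> T) \<and>
     (\<forall>i<length \<tau>. \<forall>j<length \<tau>. ys ! i < ys ! j \<longleftrightarrow> \<tau> ! i < \<tau> ! j) \<and>
     (last xs, Min (set ys)) \<in> cells Y)"

definition avoiders :: "nat list \<Rightarrow> nat list \<Rightarrow> (nat \<times> nat) set set" where
  "avoiders Y \<tau> = {T \<in> transversals Y. \<not> contains_in Y T \<tau>}"

end

theory Submission
  imports Defs "HOL-Computational_Algebra.Polynomial"
begin

text \<open>
  The first inequality compares two recursions. The second one passes through the pattern 321,
  which has as many avoiders as 123.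

  Read a transversal column by column from right to left and record the rows it uses. When a column
  is reached, some new rows open at the bottom, and the column uses one of the open rows. An
  occurrence of a pattern has its lower right corner in the diagram iff all its rows are open when
  its rightmost column is reached. For 123, using a row \<open>y\<close> therefore forces the open rows below \<open>y\<close>
  to be used later in increasing order, and for 213 in decreasing order. In both cases the open rows
  are divided into consecutive blocks with a prescribed order inside each block, new rows are
  singleton blocks, and the number of completions depends only on the block sizes
  (\<open>block_order.card_words\<close>). Using a row from a block of size \<open>b\<close> with \<open>s\<close> open rows
  below that block replaces \<open>b\<close> and everything after it by the blocks \<open>b - 1, s\<close> for 123, and by the
  single block \<open>b - 1 + s\<close> for 213. Merging blocks never increases the number of completions
  (\<open>block_count_merge\<close>), hence 213 has at most as many avoiders as 123 (\<open>block_count_le\<close>).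

  For 123, the number of completions of a state is the value of a linear functional, depending only
  on the remaining columns and the number of open rows, at the product of the Chebyshev polynomials
  indexed by the block sizes (\<open>block_count_eq_weight\<close>); the recursion becomes the identity
  \<open>X_times_cheb_prod\<close>. For 321, using a row forces the open rows above it to be used later in
  decreasing order, so a state is given by a chain of \<open>k\<close> rows and \<open>m\<close> free rows below it, and the same
  functional at the \<open>k\<close>-th Chebyshev polynomial times \<open>X ^ m\<close> counts its completions
  (\<open>chain_count_eq_weight\<close>). So 123 and 321 have equally many avoiders.

  Finally, a 321-avoider is determined by its left-to-right maxima (\<open>avoider_321_eqI\<close>). An occurrence
  of 312 can be turned into one of 321 by exchanging its two lower elements; the result stays in the
  diagram and has the same left-to-right maxima. Repeating this ends in a 312-avoider, so every set
  of left-to-right maxima of a transversal is also that of a 312-avoider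
  (\<open>exists_avoider_312_with_maxima\<close>), and 321 has at most as many avoiders as 312.
\<close>

section \<open>Words of rows and blocks of open rows\<close>

text \<open>
  A transversal is read column by column from right to left, so it becomes a list
  \<open>ys\<close> of rows; \<open>fs\<close> lists the lowest admissible rows of these columns. The relation \<open>S f y z\<close>
  says that a row \<open>z\<close> that is picked after \<open>y\<close> may take part in an occurrence whose rightmost
  element is \<open>y\<close>, in a column with lowest cell \<open>f\<close>. The rows picked out by \<open>S\<close> have to come in
  the order \<open>Q\<close>; this is how avoidance of a pattern of length 3 is expressed.
\<close>

fun sweep :: "(nat \<Rightarrow> nat \<Rightarrow> nat \<Rightarrow> bool) \<Rightarrow> (nat \<Rightarrow> nat \<Rightarrow> bool) \<Rightarrow> nat list \<Rightarrow> nat list \<Rightarrow> bool" where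
  "sweep S Q [] ys = (ys = [])"
| "sweep S Q (f # fs) [] = False"
| "sweep S Q (f # fs) (y # ys) = (f \<le> y \<and> sorted_wrt Q (filter (S f y) ys) \<and> sweep S Q fs ys)"

lemma sorted_wrt_filter_iff:
  "sorted_wrt Q (filter P ys) \<longleftrightarrow> sorted_wrt (\<lambda>a b. P a \<and> P b \<longrightarrow> Q a b) ys"
  by (induction ys) auto

lemma sorted_wrt_filter_subset:
  assumes "sorted_wrt Q (filter P ys)" and "\<And>z. z \<in> set ys \<Longrightarrow> P' z \<Longrightarrow> P z"
  shows "sorted_wrt Q (filter P' ys)"
  using assms unfolding sorted_wrt_filter_iff
  by (auto intro: sorted_wrt_mono_rel[rotated])

lemma sweep_iff_nth:
  "sweep S Q fs ys \<longleftrightarrow> length ys = length fs \<and> (\<forall>i<length fs. fs ! i \<le> ys ! i) \<and>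
     (\<forall>i j k. i < j \<longrightarrow> j < k \<longrightarrow> k < length fs \<longrightarrow>
        S (fs ! i) (ys ! i) (ys ! j) \<longrightarrow> S (fs ! i) (ys ! i) (ys ! k) \<longrightarrow> Q (ys ! j) (ys ! k))"
proof (induction S Q fs ys rule: sweep.induct)
  case (3 S Q f fs y ys)
  let ?R = "\<lambda>fs ys. \<forall>i j k. i < j \<longrightarrow> j < k \<longrightarrow> k < length fs \<longrightarrow>
        S (fs ! i) (ys ! i) (ys ! j) \<longrightarrow> S (fs ! i) (ys ! i) (ys ! k) \<longrightarrow> Q (ys ! j) (ys ! k)"
  have triples: "?R (f # fs) (y # ys) \<longleftrightarrow>
      sorted_wrt Q (filter (S f y) ys) \<and> ?R fs ys" if len: "length ys = length fs"
  proof
    assume R: "?R (f # fs) (y # ys)"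
    have "sorted_wrt Q (filter (S f y) ys)"
      unfolding sorted_wrt_filter_iff unfolding sorted_wrt_iff_nth_less
    proof (intro allI impI, elim conjE)
      fix j k assume "j < k" "k < length ys" "S f y (ys ! j)" "S f y (ys ! k)"
      then show "Q (ys ! j) (ys ! k)"
        using R[rule_format, of 0 "Suc j" "Suc k"] len by simp
    qed
    moreover have "?R fs ys"
    proof (intro allI impI)
      fix i j k assume "i < j" "j < k" "k < length fs" "S (fs ! i) (ys ! i) (ys ! j)"
        "S (fs ! i) (ys ! i) (ys ! k)"
      then show "Q (ys ! j) (ys ! k)"
        using R[rule_format, of "Suc i" "Suc j" "Suc k"] by simp
    qed
    ultimately show "sorted_wrt Q (filter (S f y) ys) \<and> ?R fs ys" ..
  next
    assume *: "sorted_wrt Q (filter (S f y) ys) \<and> ?R fs ys"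
    show "?R (f # fs) (y # ys)"
    proof (intro allI impI)
      fix i j k assume ijk: "i < j" "j < k" "k < length (f # fs)"
        "S ((f # fs) ! i) ((y # ys) ! i) ((y # ys) ! j)"
        "S ((f # fs) ! i) ((y # ys) ! i) ((y # ys) ! k)"
      obtain j' k' where jk: "j = Suc j'" "k = Suc k'"
        using ijk(1,2) by (metis Nat.lessE)
      show "Q ((y # ys) ! j) ((y # ys) ! k)"
      proof (cases i)
        case 0
        then show ?thesis
          using * ijk jk len unfolding sorted_wrt_filter_iff unfolding sorted_wrt_iff_nth_less by simp
      next
        case (Suc i')
        then show ?thesis using * ijk jk by auto
      qed
    qed
  qed
  have "(\<forall>i<length (f # fs). (f # fs) ! i \<le> (y # ys) ! i) \<longleftrightarrow> f \<le> y \<and> (\<forall>i<length fs. fs ! i \<le> ys ! i)"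
    by (auto simp: less_Suc_eq_0_disj)
  then show ?case using 3 triples by auto
qed auto

lemma card_UN_Cons:
  assumes "finite I" "inj_on h I" and "\<And>i. i \<in> I \<Longrightarrow> finite (X i)"
  shows "card (\<Union>i\<in>I. Cons (h i) ` X i) = (\<Sum>i\<in>I. card (X i))"
proof -
  have "card (\<Union>i\<in>I. Cons (h i) ` X i) = (\<Sum>i\<in>I. card (Cons (h i) ` X i))"
    using assms by (intro card_UN_disjoint) (auto dest: inj_onD)
  then show ?thesis by (simp add: card_image)
qed

text \<open>
  The rows that can play the two smaller parts of 123 or 213, given that \<open>y\<close> plays the 3. The bound
  \<open>f \<le> z\<close> puts the corner cell of the occurrence into the diagram.
\<close>

definition below :: "nat \<Rightarrow> nat \<Rightarrow> nat \<Rightarrow> bool" where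
  "below f y z \<longleftrightarrow> f \<le> z \<and> z < y"

text \<open>
  The open rows (those that meet the columns read so far and are not yet used) are cut into a list
  of blocks, from the top of the diagram to the bottom. A block may be empty. The rows of
  each block have to be used in the order \<open>Q\<close>, and there is no other obligation.
\<close>

definition decreasing_blocks :: "nat \<Rightarrow> nat set list \<Rightarrow> bool" where
  "decreasing_blocks f Bs \<longleftrightarrow> sorted_wrt (\<lambda>A B. \<forall>a\<in>A. \<forall>b\<in>B. b < a) Bs \<and>
     (\<forall>B\<in>set Bs. finite B \<and> (\<forall>z\<in>B. f \<le> z))"

lemma decreasing_blocks_nth:
  assumes "decreasing_blocks f Bs" "i < length Bs"
  shows "finite (Bs ! i)" "z \<in> Bs ! i \<Longrightarrow> f \<le> z"
    "z \<in> B \<Longrightarrow> B \<in> set (take i Bs) \<Longrightarrow> y \<in> Bs ! i \<Longrightarrow> y < z"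
    "z \<in> B \<Longrightarrow> B \<in> set (drop (Suc i) Bs) \<Longrightarrow> y \<in> Bs ! i \<Longrightarrow> z < y"
proof -
  have *: "Bs = take i Bs @ Bs ! i # drop (Suc i) Bs"
    using assms(2) by (rule id_take_nth_drop)
  have "sorted_wrt (\<lambda>A B. \<forall>a\<in>A. \<forall>b\<in>B. b < a) (take i Bs @ Bs ! i # drop (Suc i) Bs)"
    using assms(1) * unfolding decreasing_blocks_def by metis
  then show "z \<in> B \<Longrightarrow> B \<in> set (take i Bs) \<Longrightarrow> y \<in> Bs ! i \<Longrightarrow> y < z"
    "z \<in> B \<Longrightarrow> B \<in> set (drop (Suc i) Bs) \<Longrightarrow> y \<in> Bs ! i \<Longrightarrow> z < y"
    by (auto simp: sorted_wrt_append)
qed (use assms in \<open>auto simp: decreasing_blocks_def\<close>)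

lemma set_take_nth_drop:
  "i < length xs \<Longrightarrow> set xs = insert (xs ! i) (set (take i xs) \<union> set (drop (Suc i) xs))"
  by (subst id_take_nth_drop[of i xs]) auto

lemma decreasing_blocks_disjoint:
  assumes "decreasing_blocks f Bs" "i < length Bs" "j < length Bs" "y \<in> Bs ! i" "y \<in> Bs ! j"
  shows "i = j"
proof -
  have "sorted_wrt (\<lambda>A B. \<forall>a\<in>A. \<forall>b\<in>B. b < a) Bs" using assms(1) by (simp add: decreasing_blocks_def)
  then show ?thesis
    using assms unfolding sorted_wrt_iff_nth_less by (metis less_irrefl nat_neq_iff)
qed

lemma card_Union_blocks:
  "decreasing_blocks f Bs \<Longrightarrow> card (\<Union>(set Bs)) = sum_list (map card Bs)"
proof (induction Bs)
  case (Cons B Bs)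
  then have "card (B \<union> \<Union>(set Bs)) = card B + card (\<Union>(set Bs))"
    by (intro card_Un_disjoint) (fastforce simp: decreasing_blocks_def)+
  with Cons show ?case by (simp add: decreasing_blocks_def)
qed simp

lemma finite_Union_blocks: "decreasing_blocks f Bs \<Longrightarrow> finite (\<Union>(set Bs))"
  by (auto simp: decreasing_blocks_def)

text \<open>
  The block sizes after the first row of block \<open>i\<close> has been used: all open rows below it now have to
  come in the order \<open>Q\<close>, so they merge into one block. Here \<open>g b\<close> is the number of
  rows that lie above the first one in a block of size \<open>b\<close>.
\<close>

definition split_sizes :: "(nat \<Rightarrow> nat) \<Rightarrow> nat list \<Rightarrow> nat \<Rightarrow> nat list" where
  "split_sizes g bs i =
     take i bs @ [g (bs ! i), bs ! i - 1 - g (bs ! i) + sum_list (drop (Suc i) bs)]"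

text \<open>
  The number of ways to complete a transversal from a state with block sizes \<open>bs\<close>. The rows below
  \<open>c\<close> are not open yet. A column with lowest cell \<open>f\<close> first opens the rows from \<open>f\<close> to \<open>c - 1\<close> as
  singleton blocks and then uses the first row of some nonempty block. The value 1 for the empty
  list of columns is the right count when there are as many columns as rows left.
\<close>

fun block_count :: "(nat \<Rightarrow> nat) \<Rightarrow> nat list \<Rightarrow> nat \<Rightarrow> nat list \<Rightarrow> nat" where
  "block_count g bs c [] = 1"
| "block_count g bs c (f # fs) =
     (\<Sum>i | i < length bs + (c - f) \<and> (bs @ replicate (c - f) 1) ! i \<noteq> 0.
        block_count g (split_sizes g (bs @ replicate (c - f) 1) i) f fs)"

text \<open>
  The two orders, increasing and decreasing, in which the rows of a block may have to be used.
  The assumption \<open>first_extreme\<close> guarantees that what remains of a block after its first row lies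
  entirely above or entirely below that row.
\<close>

locale block_order =
  fixes Q :: "nat \<Rightarrow> nat \<Rightarrow> bool" and first :: "nat set \<Rightarrow> nat" and g :: "nat \<Rightarrow> nat"
  assumes Q_asym: "Q a b \<Longrightarrow> \<not> Q b a"
    and first_in: "finite B \<Longrightarrow> B \<noteq> {} \<Longrightarrow> first B \<in> B"
    and first_Q: "finite B \<Longrightarrow> z \<in> B \<Longrightarrow> z \<noteq> first B \<Longrightarrow> Q (first B) z"
    and first_extreme: "finite B \<Longrightarrow> B \<noteq> {} \<Longrightarrow> (\<forall>z\<in>B. first B \<le> z) \<or> (\<forall>z\<in>B. z \<le> first B)"
    and card_above_first: "finite B \<Longrightarrow> B \<noteq> {} \<Longrightarrow> card {z \<in> B. first B < z} = g (card B)"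
begin

text \<open>
  The completions of a state given by the blocks \<open>Bs\<close>, where the rows below \<open>c\<close> are not open yet.
\<close>

definition words :: "nat set list \<Rightarrow> nat \<Rightarrow> nat list \<Rightarrow> nat list set" where
  "words Bs c fs = {ys. distinct ys \<and> set ys = \<Union>(set Bs) \<union> {1..<c} \<and> sweep below Q fs ys \<and>
     (\<forall>B\<in>set Bs. sorted_wrt Q (filter (\<lambda>z. z \<in> B) ys))}"

text \<open>
  The state after the first row of block \<open>i\<close> has been used. At least one of the two
  parts of block \<open>i\<close> itself is empty; keeping an empty block treats both orders uniformly.
\<close>

definition split_blocks :: "nat set list \<Rightarrow> nat \<Rightarrow> nat set list" where
  "split_blocks Bs i = take i Bs @
     [{z \<in> Bs ! i. first (Bs ! i) < z}, {z \<in> \<Union>(set (drop i Bs)). z < first (Bs ! i)}]"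

lemma finite_words: "finite (\<Union>(set Bs)) \<Longrightarrow> finite (words Bs c fs)"
  by (rule finite_subset[OF _ finite_subset_distinct[of "\<Union>(set Bs) \<union> {1..<c}"]])
     (auto simp: words_def)

lemma words_open:
  assumes "f \<le> c" "1 \<le> f"
  shows "words Bs c fs = words (Bs @ map (\<lambda>z. {z}) (rev [f..<c])) f fs"
proof -
  have "\<Union>(set Bs) \<union> {1..<c} = \<Union>(set (Bs @ map (\<lambda>z. {z}) (rev [f..<c]))) \<union> {1..<f}"
    using assms by auto
  moreover have "sorted_wrt Q (filter (\<lambda>z. z \<in> {w}) ys)" if "distinct ys" for w ys
    using that by (induction ys) (auto simp: filter_empty_conv)
  ultimately show ?thesis unfolding words_def by auto
qed

lemma decreasing_blocks_open:
  assumes "decreasing_blocks c Bs" "f \<le> c"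
  shows "decreasing_blocks f (Bs @ map (\<lambda>z. {z}) (rev [f..<c]))"
  using assms by (fastforce simp: decreasing_blocks_def sorted_wrt_append sorted_wrt_map sorted_wrt_rev)

lemma split_blocks_facts:
  assumes "decreasing_blocks f Bs" "i < length Bs" "Bs ! i \<noteq> {}"
  shows "decreasing_blocks f (split_blocks Bs i)"
    "\<Union>(set (split_blocks Bs i)) = \<Union>(set Bs) - {first (Bs ! i)}"
    "map card (split_blocks Bs i) = split_sizes g (map card Bs) i"
proof -
  note nth = decreasing_blocks_nth[OF assms(1,2)]
  define y where "y = first (Bs ! i)"
  have y: "y \<in> Bs ! i" using first_in[OF nth(1) assms(3)] by (simp add: y_def)
  have drop: "drop i Bs = Bs ! i # drop (Suc i) Bs"
    using assms(2) by (simp add: Cons_nth_drop_Suc)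
  have dec_take: "decreasing_blocks f (take i Bs)" and dec_drop: "decreasing_blocks f (drop (Suc i) Bs)"
    using assms(1) unfolding decreasing_blocks_def
    by (auto simp: sorted_wrt_take sorted_wrt_drop dest: in_set_takeD in_set_dropD)
  show "decreasing_blocks f (split_blocks Bs i)"
  proof -
    have lt: "b < a" if "A \<in> set (take i Bs)" "a \<in> A" "b \<in> \<Union>(set (drop i Bs))" for A a b
    proof -
      have "y < a" "b \<in> Bs ! i \<Longrightarrow> b < a" using nth(3)[OF that(2,1)] y by auto
      moreover have "b < y" if "b \<notin> Bs ! i" using nth(4) y \<open>b \<in> _\<close> that drop by auto
      ultimately show ?thesis by (metis less_trans)
    qed
    have "finite (\<Union>(set (drop i Bs)))" "\<forall>z\<in>\<Union>(set (drop i Bs)). f \<le> z"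
      using finite_Union_blocks[OF dec_drop] nth(1,2) dec_drop
      unfolding drop decreasing_blocks_def by auto
    moreover have "b < a" if "A \<in> set (take i Bs)" "a \<in> A" "b \<in> Bs ! i" for A a b
      using lt[OF that(1,2), of b] that(3) unfolding drop by auto
    ultimately show ?thesis
      using dec_take lt nth(1,2)
      unfolding split_blocks_def y_def[symmetric] decreasing_blocks_def sorted_wrt_append
      by (auto simp del: Union_iff)
  qed
  show "\<Union>(set (split_blocks Bs i)) = \<Union>(set Bs) - {first (Bs ! i)}"
  proof -
    have "z \<noteq> y" if "B \<in> set (take i Bs)" "z \<in> B" for B z using nth(3)[OF that(2,1) y] by simp
    moreover have "z < y" if "B \<in> set (drop (Suc i) Bs)" "z \<in> B" for B z
      using nth(4)[OF that(2,1) y] .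
    ultimately show ?thesis
      unfolding set_take_nth_drop[OF assms(2)] split_blocks_def y_def[symmetric] drop
      by (auto simp: nat_neq_iff)
  qed
  have fin: "finite (Bs ! i)" by (rule nth(1))
  have "{z \<in> \<Union>(set (drop i Bs)). z < y} = {z \<in> Bs ! i. z < y} \<union> \<Union>(set (drop (Suc i) Bs))"
    unfolding drop using nth(4) y by auto
  moreover have "card ({z \<in> Bs ! i. z < y} \<union> \<Union>(set (drop (Suc i) Bs))) =
      card {z \<in> Bs ! i. z < y} + sum_list (map card (drop (Suc i) Bs))"
    unfolding card_Union_blocks[OF dec_drop, symmetric]
  proof (rule card_Un_disjoint)
    show "{z \<in> Bs ! i. z < y} \<inter> \<Union>(set (drop (Suc i) Bs)) = {}"
    proof (intro equals0I, elim IntE UnionE)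
      fix z B assume "z \<in> {z \<in> Bs ! i. z < y}" "z \<in> B" "B \<in> set (drop (Suc i) Bs)"
      then show False using nth(4)[of z B z] by simp
    qed
  qed (use fin finite_Union_blocks[OF dec_drop] in auto)
  moreover have "card {z \<in> Bs ! i. z < y} = card (Bs ! i) - 1 - g (card (Bs ! i))"
  proof -
    have "Bs ! i = insert y ({z \<in> Bs ! i. z < y} \<union> {z \<in> Bs ! i. y < z})" using y by auto
    also have "card \<dots> = Suc (card {z \<in> Bs ! i. z < y} + card {z \<in> Bs ! i. y < z})"
      using fin by (subst card_insert_disjoint) (auto intro!: card_Un_disjoint)
    finally show ?thesis using card_above_first[OF fin assms(3)] by (simp add: y_def)
  qed
  ultimately show "map card (split_blocks Bs i) = split_sizes g (map card Bs) i"
    unfolding split_blocks_def split_sizes_def y_def[symmetric]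
    using card_above_first[OF fin assms(3)] assms(2) by (simp add: y_def take_map drop_map)
qed

text \<open>
  The first row of a completion is the first row of its block, because the other rows of that
  block have to come later. The obligations that the sweep adds are exactly those
  of the merged block.
\<close>

lemma words_pick:
  assumes dec: "decreasing_blocks f Bs"
  shows "words Bs f (f # fs) = (\<Union>i\<in>{i. i < length Bs \<and> Bs ! i \<noteq> {}}.
           Cons (first (Bs ! i)) ` words (split_blocks Bs i) f fs)"
proof (intro equalityI subsetI)
  fix w assume w: "w \<in> words Bs f (f # fs)"
  then obtain y ys where wy: "w = y # ys" by (cases w) (auto simp: words_def)
  have w': "distinct (y # ys)" "set (y # ys) = \<Union>(set Bs) \<union> {1..<f}" "f \<le> y"
    "sorted_wrt Q (filter (below f y) ys)" "sweep below Q fs ys"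
    "\<And>B. B \<in> set Bs \<Longrightarrow> sorted_wrt Q (filter (\<lambda>z. z \<in> B) (y # ys))"
    using w unfolding words_def wy by auto
  have "y \<in> \<Union>(set Bs)"
  proof -
    have "y \<in> \<Union>(set Bs) \<union> {1..<f}" using w'(2) by (metis list.set_intros(1))
    then show ?thesis using w'(3) by auto
  qed
  then obtain i where i: "i < length Bs" "y \<in> Bs ! i" by (auto simp: in_set_conv_nth)
  note nth = decreasing_blocks_nth[OF dec i(1)]
  have ne: "Bs ! i \<noteq> {}" using i by auto
  have y: "y = first (Bs ! i)"
  proof (rule ccontr)
    assume neq: "y \<noteq> first (Bs ! i)"
    have "first (Bs ! i) \<in> Bs ! i" using first_in nth(1) ne by blast
    then have "first (Bs ! i) \<in> set (filter (\<lambda>z. z \<in> Bs ! i) ys)"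
      using w'(2) neq i by (auto; metis Un_iff UnionI insertE nth_mem)
    then have "Q y (first (Bs ! i))" using w'(6)[of "Bs ! i"] i by auto
    then show False using first_Q[OF nth(1) i(2) neq] Q_asym by blast
  qed
  note sf = split_blocks_facts[OF dec i(1) ne, folded y]
  have "set ys = \<Union>(set (split_blocks Bs i)) \<union> {1..<f}"
  proof -
    have "set ys = (\<Union>(set Bs) \<union> {1..<f}) - {y}" using w'(1) unfolding w'(2)[symmetric] by auto
    then show ?thesis using sf(2) w'(3) by auto
  qed
  moreover have "sorted_wrt Q (filter (\<lambda>z. z \<in> B) ys)" if B: "B \<in> set (split_blocks Bs i)" for B
  proof -
    consider "B \<in> set (take i Bs)" | "B \<subseteq> Bs ! i" | "\<forall>z\<in>B. f \<le> z \<and> z < y"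
      using B sf(1) unfolding split_blocks_def y[symmetric] decreasing_blocks_def by auto
    then show ?thesis
    proof cases
      case 1
      then show ?thesis using w'(6)[of B] by (auto dest: in_set_takeD split: if_splits)
    next
      case 2
      have "sorted_wrt Q (filter (\<lambda>z. z \<in> Bs ! i) ys)" using w'(6)[of "Bs ! i"] i by auto
      then show ?thesis by (rule sorted_wrt_filter_subset) (use 2 in auto)
    next
      case 3
      show ?thesis by (rule sorted_wrt_filter_subset[OF w'(4)]) (use 3 in \<open>auto simp: below_def\<close>)
    qed
  qed
  ultimately have "ys \<in> words (split_blocks Bs i) f fs"
    using w' by (auto simp: words_def)
  then show "w \<in> (\<Union>i\<in>{i. i < length Bs \<and> Bs ! i \<noteq> {}}.
           Cons (first (Bs ! i)) ` words (split_blocks Bs i) f fs)"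
    using wy y i ne by auto
next
  fix w assume "w \<in> (\<Union>i\<in>{i. i < length Bs \<and> Bs ! i \<noteq> {}}.
           Cons (first (Bs ! i)) ` words (split_blocks Bs i) f fs)"
  then obtain i ys where i: "i < length Bs" "Bs ! i \<noteq> {}" and ys: "ys \<in> words (split_blocks Bs i) f fs"
    and w: "w = first (Bs ! i) # ys" by auto
  define y where "y = first (Bs ! i)"
  note nth = decreasing_blocks_nth[OF dec i(1)]
  note sf = split_blocks_facts[OF dec i, folded y_def]
  have yin: "y \<in> Bs ! i" using first_in nth(1) i by (simp add: y_def)
  have drop: "drop i Bs = Bs ! i # drop (Suc i) Bs"
    using i(1) by (simp add: Cons_nth_drop_Suc)
  have ys': "distinct ys" "set ys = (\<Union>(set Bs) - {y}) \<union> {1..<f}" "sweep below Q fs ys"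
    "\<And>B. B \<in> set (split_blocks Bs i) \<Longrightarrow> sorted_wrt Q (filter (\<lambda>z. z \<in> B) ys)"
    using ys sf(2) by (auto simp: words_def)
  have fy: "f \<le> y" using nth(2) yin by auto
  have lower: "sorted_wrt Q (filter (\<lambda>z. z \<in> \<Union>(set (drop i Bs)) \<and> z < y) ys)"
    using ys'(4)[of "{z \<in> \<Union>(set (drop i Bs)). z < y}"] by (simp add: split_blocks_def y_def)
  have upper: "sorted_wrt Q (filter (\<lambda>z. z \<in> Bs ! i \<and> y < z) ys)"
    using ys'(4)[of "{z \<in> Bs ! i. y < z}"] by (simp add: split_blocks_def y_def)
  have "sorted_wrt Q (filter (below f y) ys)"
  proof (rule sorted_wrt_filter_subset[OF lower])
    fix z assume z: "z \<in> set ys" "below f y z"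
    then have "z \<in> \<Union>(set Bs)" using ys'(2) by (auto simp: below_def)
    then show "z \<in> \<Union>(set (drop i Bs)) \<and> z < y"
      unfolding set_take_nth_drop[OF i(1)] drop using nth(3) yin z(2) by (auto simp: below_def; fastforce)
  qed
  moreover have "sorted_wrt Q (filter (\<lambda>z. z \<in> B) (y # ys))" if B: "B \<in> set Bs" for B
  proof -
    consider "B \<in> set (take i Bs)" | "B = Bs ! i" | "B \<in> set (drop (Suc i) Bs)"
      using B unfolding set_take_nth_drop[OF i(1)] by blast
    then show ?thesis
    proof cases
      case 1
      then have "y \<notin> B" using nth(3) yin by blast
      then show ?thesis using ys'(4)[of B] 1 by (simp add: split_blocks_def)
    next
      case 2
      consider "\<forall>z\<in>B. y \<le> z" | "\<forall>z\<in>B. z \<le> y" using first_extreme[OF nth(1) i(2)] 2 y_def by blast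
      then have "sorted_wrt Q (filter (\<lambda>z. z \<in> B) ys)"
      proof cases
        case 1
        show ?thesis
          by (rule sorted_wrt_filter_subset[OF upper]) (use 1 2 ys'(2) fy in \<open>auto simp: order.order_iff_strict; fastforce\<close>)
      next
        case le: 2
        show ?thesis
          by (rule sorted_wrt_filter_subset[OF lower]) (use le 2 drop ys'(2) fy in \<open>auto simp: order.order_iff_strict; fastforce\<close>)
      qed
      moreover have "Q y z" if "z \<in> set ys" "z \<in> B" for z
        using first_Q[OF nth(1), of z] that 2 ys'(2) fy by (auto simp: y_def)
      ultimately show ?thesis using 2 yin by simp
    next
      case 3
      then have "y \<notin> B" using nth(4) yin by blast
      moreover have "sorted_wrt Q (filter (\<lambda>z. z \<in> B) ys)"
        by (rule sorted_wrt_filter_subset[OF lower]) (use 3 drop nth(4) yin in auto)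
      ultimately show ?thesis by simp
    qed
  qed
  moreover have "y \<in> \<Union>(set Bs)" using yin i nth_mem by blast
  ultimately show "w \<in> words Bs f (f # fs)"
    using ys'(1,2,3) fy unfolding w y_def[symmetric] words_def by auto
qed

theorem card_words:
  assumes "decreasing_blocks c Bs" "sorted_wrt (\<ge>) (c # fs)" "\<forall>f\<in>set fs. 1 \<le> f"
    and "card (\<Union>(set Bs)) + c = Suc (length fs)" "1 \<le> c"
  shows "card (words Bs c fs) = block_count g (map card Bs) c fs"
  using assms
proof (induction fs arbitrary: Bs c)
  case Nil
  then have "card (\<Union>(set Bs)) = 0" "c = 1" by auto
  then have "c = 1" "\<Union>(set Bs) = {}" using finite_Union_blocks[OF Nil(1)] by (simp_all only: card_0_eq)
  then have "words Bs c [] = {[]}" by (auto simp: words_def)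
  then show ?case by simp
next
  case (Cons f fs)
  then have fc: "f \<le> c" "1 \<le> f" by auto
  define Bs' where "Bs' = Bs @ map (\<lambda>z. {z}) (rev [f..<c])"
  define I where "I = {i. i < length Bs' \<and> Bs' ! i \<noteq> {}}"
  have dec: "decreasing_blocks f Bs'"
    unfolding Bs'_def using Cons.prems(1) fc(1) by (rule decreasing_blocks_open)
  have "card (\<Union>(set Bs')) + f = Suc (length (f # fs))"
    using card_Union_blocks[OF dec] card_Union_blocks[OF Cons.prems(1)] Cons.prems(4) fc
    by (simp add: Bs'_def comp_def sum_list_triv)
  then have bal: "card (\<Union>(set (split_blocks Bs' i))) + f = Suc (length fs)" if "i \<in> I" for i
  proof -
    have i: "i < length Bs'" "Bs' ! i \<noteq> {}" using that by (auto simp: I_def)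
    then have "first (Bs' ! i) \<in> Bs' ! i" using first_in decreasing_blocks_nth(1)[OF dec] by blast
    then have "first (Bs' ! i) \<in> \<Union>(set Bs')" using i nth_mem by blast
    then have "card (\<Union>(set Bs')) = Suc (card (\<Union>(set Bs') - {first (Bs' ! i)}))"
      using finite_Union_blocks[OF dec] by (metis card_Suc_Diff1)
    then show ?thesis
      using \<open>card (\<Union>(set Bs')) + f = _\<close> split_blocks_facts(2)[OF dec i] by simp
  qed
  have "card (words Bs c (f # fs)) =
      card (\<Union>i\<in>I. Cons (first (Bs' ! i)) ` words (split_blocks Bs' i) f fs)"
    using words_open[OF fc, of Bs "f # fs"] words_pick[OF dec, of fs] by (simp add: Bs'_def I_def)
  also have "\<dots> = (\<Sum>i\<in>I. card (words (split_blocks Bs' i) f fs))"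
  proof (rule card_UN_Cons)
    show "inj_on (\<lambda>i. first (Bs' ! i)) I"
    proof (rule inj_onI)
      fix i j assume "i \<in> I" "j \<in> I" "first (Bs' ! i) = first (Bs' ! j)"
      then show "i = j"
        using first_in decreasing_blocks_nth(1)[OF dec] decreasing_blocks_disjoint[OF dec, of i j]
        unfolding I_def by (metis (mono_tags, lifting) mem_Collect_eq)
    qed
  next
    fix i assume "i \<in> I"
    then show "finite (words (split_blocks Bs' i) f fs)"
      using split_blocks_facts(1)[OF dec, of i] finite_Union_blocks
      by (intro finite_words) (auto simp: I_def)
  qed (simp add: I_def)
  also have "\<dots> = (\<Sum>i\<in>I. block_count g (split_sizes g (map card Bs') i) f fs)"
  proof (rule sum.cong[OF refl])
    fix i assume "i \<in> I"
    then show "card (words (split_blocks Bs' i) f fs) = block_count g (split_sizes g (map card Bs') i) f fs"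
      using Cons.IH[of f "split_blocks Bs' i"] split_blocks_facts[OF dec, of i] bal[of i] Cons.prems fc
      by (simp add: I_def)
  qed
  also have "map card Bs' = map card Bs @ replicate (c - f) 1"
    by (simp add: Bs'_def comp_def map_replicate_const)
  also have "I = {i. i < length (map card Bs) + (c - f) \<and> (map card Bs @ replicate (c - f) 1) ! i \<noteq> 0}"
  proof -
    have "(map card Bs @ replicate (c - f) 1) ! i \<noteq> 0 \<longleftrightarrow> Bs' ! i \<noteq> {}" if "i < length Bs'" for i
    proof -
      have "(map card Bs @ replicate (c - f) 1) ! i = card (Bs' ! i)"
        using that unfolding \<open>map card Bs' = _\<close>[symmetric] by simp
      then show ?thesis using decreasing_blocks_nth(1)[OF dec that] by simp
    qed
    moreover have "length Bs' = length (map card Bs) + (c - f)" by (simp add: Bs'_def)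
    ultimately show ?thesis unfolding I_def by (metis (lifting))
  qed
  finally show ?case by (simp only: block_count.simps)
qed

end

text \<open>
  For the pattern 123 blocks are picked in increasing order, for 213 in decreasing order.
\<close>

interpretation ascending: block_order "(<)" Min "\<lambda>b. b - 1"
proof
  fix B :: "nat set" assume B: "finite B" "B \<noteq> {}"
  have "{z \<in> B. Min B < z} = B - {Min B}"
    using B by (auto simp: order.strict_iff_order)
  then show "card {z \<in> B. Min B < z} = card B - 1" using B by (simp add: card_Diff_singleton)
qed (auto simp: order.strict_iff_order)

interpretation descending: block_order "(>)" Max "\<lambda>b. 0"
proof
  fix B :: "nat set" assume B: "finite B" "B \<noteq> {}"
  have "{z \<in> B. Max B < z} = {}"
    using B by (auto simp: not_less)
  then show "card {z \<in> B. Max B < z} = 0" by (simp only: card.empty)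
qed (auto simp: order.strict_iff_order)


section \<open>Chebyshev polynomials and the comparison of the counts\<close>

text \<open>
  The Chebyshev polynomials of the second kind, rescaled to be monic: \<open>U\<^sub>n(x / 2)\<close>. They are
  the characters of the irreducible representations of SL(2), so products of them expand by the
  Clebsch-Gordan rule.
\<close>

fun cheb :: "nat \<Rightarrow> int poly" where
  "cheb 0 = 1"
| "cheb (Suc 0) = [:0, 1:]"
| "cheb (Suc (Suc n)) = [:0, 1:] * cheb (Suc n) - cheb n"

abbreviation X :: "int poly" where "X \<equiv> [:0, 1:]"

lemma X_cheb: "X * cheb (Suc n) = cheb (Suc (Suc n)) + cheb n"
  by simp

lemma degree_lead_cheb: "degree (cheb n) = n \<and> coeff (cheb n) n = 1"
proof (induction n rule: cheb.induct)
  case (3 n)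
  then have "cheb (Suc n) \<noteq> 0" by auto
  then have "degree (X * cheb (Suc n)) = Suc (Suc n)" using 3 by (simp add: degree_mult_eq)
  moreover have "degree (cheb n) < Suc (Suc n)" using 3 by simp
  ultimately have "degree (cheb (Suc (Suc n))) = Suc (Suc n)"
    by (metis cheb.simps(3) degree_add_eq_left diff_conv_add_uminus degree_minus)
  moreover have "coeff (cheb n) (Suc (Suc n)) = 0" using 3 by (simp add: coeff_eq_0)
  ultimately show ?case using 3 by simp
qed auto

lemma lead_coeff_cheb: "lead_coeff (cheb n) = 1" and degree_cheb: "degree (cheb n) = n"
  using degree_lead_cheb[of n] by auto

lemma cheb_nonzero: "cheb n \<noteq> 0"
  using lead_coeff_cheb[of n] by auto

text \<open>
  One step of the Clebsch-Gordan rule.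
\<close>

lemma cheb_mult_Suc: "cheb (Suc m) * cheb (Suc n) = cheb (m + n + 2) + cheb m * cheb n"
proof (induction m arbitrary: n rule: less_induct)
  case (less m)
  show ?case
  proof (cases m)
    case 0
    then show ?thesis using X_cheb[of n] by simp
  next
    case (Suc k)
    have "cheb (Suc m) * cheb (Suc n) = X * cheb m * cheb (Suc n) - cheb k * cheb (Suc n)"
      by (simp add: Suc algebra_simps)
    also have "X * cheb m * cheb (Suc n) = cheb m * (cheb (Suc (Suc n)) + cheb n)"
      by (subst X_cheb[symmetric]) (simp add: mult_ac)
    also have "cheb m * (cheb (Suc (Suc n)) + cheb n) = cheb (Suc k) * cheb (Suc (Suc n)) + cheb m * cheb n"
      by (simp add: Suc algebra_simps)
    also have "cheb (Suc k) * cheb (Suc (Suc n)) = cheb (k + Suc n + 2) + cheb k * cheb (Suc n)"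
      by (rule less.IH) (simp add: Suc)
    finally show ?thesis by (simp add: Suc)
  qed
qed

definition cheb_prod :: "nat list \<Rightarrow> int poly" where
  "cheb_prod bs = prod_list (map cheb bs)"

lemma cheb_prod_simps:
  "cheb_prod [] = 1" "cheb_prod (b # bs) = cheb b * cheb_prod bs"
  "cheb_prod (as @ bs) = cheb_prod as * cheb_prod bs" "cheb_prod (replicate k 1) = X ^ k"
  by (simp_all add: cheb_prod_def)

lemma lead_coeff_cheb_prod: "lead_coeff (cheb_prod bs) = 1"
  by (induction bs) (simp_all add: cheb_prod_simps lead_coeff_mult lead_coeff_cheb)

lemma degree_cheb_prod: "degree (cheb_prod bs) = sum_list bs"
proof (induction bs)
  case (Cons b bs)
  have "cheb_prod bs \<noteq> 0" using lead_coeff_cheb_prod[of bs] by auto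
  then show ?case using Cons by (simp add: cheb_prod_simps degree_mult_eq cheb_nonzero degree_cheb)
qed (simp add: cheb_prod_simps)

text \<open>
  The identity that makes the count for 123 independent of the order of the blocks: up to one
  polynomial of top degree, multiplication by \<open>X\<close> is the sum over all ways of using a row.
\<close>

lemma X_times_cheb_prod:
  "X * cheb_prod bs = cheb (Suc (sum_list bs)) +
     (\<Sum>i | i < length bs \<and> bs ! i \<noteq> 0. cheb_prod (split_sizes (\<lambda>b. b - 1) bs i))"
proof (induction bs)
  case (Cons b bs)
  let ?s = "sum_list bs"
  let ?split = "\<lambda>bs i. cheb_prod (split_sizes (\<lambda>b. b - 1) bs i)"
  let ?I = "{i. i < length bs \<and> bs ! i \<noteq> 0}"
  have idx: "{i. i < length (b # bs) \<and> (b # bs) ! i \<noteq> 0} = (if b \<noteq> 0 then {0} else {}) \<union> Suc ` ?I"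
    by (auto simp: image_iff less_Suc_eq_0_disj)
  have "(\<Sum>i | i < length (b # bs) \<and> (b # bs) ! i \<noteq> 0. ?split (b # bs) i) =
     (if b \<noteq> 0 then ?split (b # bs) 0 else 0) + (\<Sum>i\<in>Suc ` ?I. ?split (b # bs) i)"
    unfolding idx by (subst sum.union_disjoint) auto
  also have "(\<Sum>i\<in>Suc ` ?I. ?split (b # bs) i) = cheb b * (\<Sum>i\<in>?I. ?split bs i)"
    by (subst sum.reindex) (auto simp: sum_distrib_left split_sizes_def cheb_prod_simps mult.assoc)
  also have "(\<Sum>i\<in>?I. ?split bs i) = X * cheb_prod bs - cheb (Suc ?s)"
    using Cons by simp
  finally have "(\<Sum>i | i < length (b # bs) \<and> (b # bs) ! i \<noteq> 0. ?split (b # bs) i) =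
     (if b \<noteq> 0 then cheb (b - 1) * cheb ?s else 0) + cheb b * (X * cheb_prod bs - cheb (Suc ?s))"
    by (simp add: split_sizes_def cheb_prod_simps)
  moreover have "(if b \<noteq> 0 then cheb (b - 1) * cheb ?s else 0) + cheb (Suc (b + ?s)) = cheb b * cheb (Suc ?s)"
    by (cases b) (simp_all add: cheb_mult_Suc)
  ultimately show ?case by (simp add: cheb_prod_simps algebra_simps)
qed (simp add: cheb_prod_simps)

text \<open>
  A linear functional, meant for polynomials \<open>p\<close> of degree at most \<open>h\<close> and of the same parity as
  \<open>h\<close>, where \<open>h\<close> is the number of open rows. Every opened row and every column multiplies \<open>p\<close> by \<open>X\<close>. After a column has used a row,
  the degree has to drop again, so the component along the Chebyshev polynomial of top degree is
  removed; as these polynomials are monic, that component is the coefficient of \<open>X ^ Suc h'\<close>.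
\<close>

fun weight :: "nat \<Rightarrow> int poly \<Rightarrow> nat \<Rightarrow> nat list \<Rightarrow> int" where
  "weight h p c [] = coeff p h"
| "weight h p c (f # fs) =
     (let h' = h + (c - f); q = X ^ Suc (c - f) * p
      in weight (h' - 1) (q - smult (coeff q (Suc h')) (cheb (Suc h'))) f fs)"

lemma weight_add: "weight h (p + q) c fs = weight h p c fs + weight h q c fs"
proof (induction fs arbitrary: h p q c)
  case (Cons f fs)
  let ?m = "X ^ Suc (c - f)" and ?k = "Suc (h + (c - f))"
  let ?t = "\<lambda>r. ?m * r - smult (coeff (?m * r) ?k) (cheb ?k)"
  have "?t (p + q) = ?t p + ?t q"
    unfolding distrib_left coeff_add smult_add_left by simp
  then show ?case using Cons by (simp only: weight.simps Let_def)
qed simp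

lemma weight_0: "weight h 0 c fs = 0"
  using weight_add[of h 0 0 c fs] by simp

lemma weight_sum: "weight h (\<Sum>i\<in>I. p i) c fs = (\<Sum>i\<in>I. weight h (p i) c fs)"
  by (induction I rule: infinite_finite_induct) (simp_all add: weight_0 weight_add)

lemma weight_Cons:
  fixes p r :: "int poly"
  assumes "X ^ Suc (c - f) * p = cheb (Suc (h + (c - f))) + r"
    and "degree p = h" "lead_coeff p = 1"
  shows "weight h p c (f # fs) = weight (h + (c - f) - 1) r f fs"
proof -
  have "coeff (X ^ Suc (c - f) * p) (Suc (h + (c - f))) = 1"
  proof -
    have "p \<noteq> 0"
    proof
      assume "p = 0"
      with assms(3) show False by simp
    qed
    then have "degree (X ^ Suc (c - f) * p) = Suc (h + (c - f))"
      unfolding assms(2)[symmetric] by (simp add: degree_mult_eq degree_power_eq)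
    moreover have "lead_coeff (X ^ Suc (c - f) * p) = 1"
      unfolding lead_coeff_mult lead_coeff_power assms(3) by simp
    ultimately show ?thesis by metis
  qed
  then show ?thesis
    unfolding weight.simps Let_def assms(1) by simp
qed

lemma sum_list_split_sizes:
  assumes "i < length bs" "bs ! i \<noteq> 0" "g (bs ! i) < bs ! i"
  shows "sum_list (split_sizes g bs i) = sum_list bs - 1"
proof -
  have "sum_list bs = sum_list (take i bs) + bs ! i + sum_list (drop (Suc i) bs)"
    by (subst id_take_nth_drop[OF assms(1)]) simp
  then show ?thesis using assms(2,3) by (simp add: split_sizes_def)
qed

lemma block_count_eq_weight:
  "int (block_count (\<lambda>b. b - 1) bs c fs) = weight (sum_list bs) (cheb_prod bs) c fs"
proof (induction fs arbitrary: bs c)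
  case Nil
  then show ?case using lead_coeff_cheb_prod[of bs] by (simp add: degree_cheb_prod)
next
  case (Cons f fs)
  define bs' where "bs' = bs @ replicate (c - f) 1"
  let ?g = "\<lambda>b::nat. b - 1"
  let ?I = "{i. i < length bs' \<and> bs' ! i \<noteq> 0}"
  have sum': "sum_list bs' = sum_list bs + (c - f)"
    by (simp add: bs'_def sum_list_replicate)
  have "X ^ Suc (c - f) * cheb_prod bs = X * cheb_prod bs'"
    by (simp only: bs'_def cheb_prod_simps power_Suc mult_ac)
  then have "weight (sum_list bs) (cheb_prod bs) c (f # fs) =
      weight (sum_list bs' - 1) (\<Sum>i\<in>?I. cheb_prod (split_sizes ?g bs' i)) f fs"
    using X_times_cheb_prod[of bs'] degree_cheb_prod[of bs] lead_coeff_cheb_prod[of bs]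
    unfolding sum' by (intro weight_Cons) simp_all
  also have "\<dots> = (\<Sum>i\<in>?I. weight (sum_list (split_sizes ?g bs' i)) (cheb_prod (split_sizes ?g bs' i)) f fs)"
    unfolding weight_sum by (intro sum.cong refl) (simp add: sum_list_split_sizes)
  also have "\<dots> = (\<Sum>i\<in>?I. int (block_count ?g (split_sizes ?g bs' i) f fs))"
    using Cons by simp
  finally show ?case by (simp add: bs'_def)
qed

text \<open>
  In particular, empty blocks can be dropped and blocks can be permuted.
\<close>

lemma block_count_eqI:
  assumes "sum_list as = sum_list bs" "cheb_prod as = cheb_prod bs"
  shows "block_count (\<lambda>b. b - 1) as c fs = block_count (\<lambda>b. b - 1) bs c fs"
  using block_count_eq_weight[of as c fs] block_count_eq_weight[of bs c fs] assms by simp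

text \<open>
  Merging two adjacent blocks adds obligations, so it does not increase the number of completions.
  The merged block is accompanied by an empty one to keep the positions of the other blocks.
\<close>

lemma block_count_merge:
  "block_count (\<lambda>b. b - 1) (p @ [0, a + b] @ q) c fs \<le> block_count (\<lambda>b. b - 1) (p @ [a, b] @ q) c fs"
proof (induction fs arbitrary: p a b q c)
  case (Cons f fs)
  let ?g = "\<lambda>b::nat. b - 1"
  show ?case
    \<comment> \<open>For \<open>b = 0\<close> the two lists differ by a permutation of the blocks.\<close>
  proof (cases "b = 0")
    case True
    then show ?thesis
      by (intro eq_refl block_count_eqI) (simp_all add: cheb_prod_simps)
  next
    case False
    define r where "r = q @ replicate (c - f) 1"
    define xs where "xs = p @ [0, a + b] @ r"
    define ys where "ys = p @ [a, b] @ r"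
    have "(\<Sum>i | i < length xs \<and> xs ! i \<noteq> 0. block_count ?g (split_sizes ?g xs i) f fs) \<le>
          (\<Sum>i | i < length ys \<and> ys ! i \<noteq> 0. block_count ?g (split_sizes ?g ys i) f fs)"
    proof (rule sum_mono2[OF _ _ _, THEN order.trans[rotated]])
      show "{i. i < length xs \<and> xs ! i \<noteq> 0} \<subseteq> {i. i < length ys \<and> ys ! i \<noteq> 0}"
        using False by (auto simp: xs_def ys_def nth_append nth_Cons split: if_splits nat.splits)
      show "(\<Sum>i | i < length xs \<and> xs ! i \<noteq> 0. block_count ?g (split_sizes ?g xs i) f fs) \<le>
          (\<Sum>i | i < length xs \<and> xs ! i \<noteq> 0. block_count ?g (split_sizes ?g ys i) f fs)"
      proof (rule sum_mono)
        fix i assume "i \<in> {i. i < length xs \<and> xs ! i \<noteq> 0}"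
        then have i: "i < length xs" "xs ! i \<noteq> 0" by auto
        then consider "i < length p" | "i = Suc (length p)" |
            j where "i = length p + 2 + j" "j < length r"
        proof -
          have "i < length p \<or> i = length p \<or> i = Suc (length p) \<or> (\<exists>j. i = length p + 2 + j \<and> j < length r)"
            using i(1) by (simp add: xs_def) presburger
          moreover have "i \<noteq> length p" using i(2) by (auto simp: xs_def)
          ultimately show ?thesis using that by blast
        qed
        then show "block_count ?g (split_sizes ?g xs i) f fs \<le> block_count ?g (split_sizes ?g ys i) f fs"
        proof cases
          case 1
          then have "split_sizes ?g xs i = split_sizes ?g ys i"
            by (simp add: split_sizes_def xs_def ys_def nth_append)
          then show ?thesis by simp
        next
          case 2
          then have "split_sizes ?g xs i = p @ [0, a + (b - 1)] @ [sum_list r]"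
            "split_sizes ?g ys i = p @ [a, b - 1] @ [sum_list r]"
            using False by (simp_all add: split_sizes_def xs_def ys_def nth_append)
          then show ?thesis by (simp only: Cons.IH)
        next
          case 3
          then have "split_sizes ?g xs i = p @ [0, a + b] @ split_sizes ?g r j"
            "split_sizes ?g ys i = p @ [a, b] @ split_sizes ?g r j"
            by (simp_all add: split_sizes_def xs_def ys_def nth_append numeral_eq_Suc)
          then show ?thesis by (simp only: Cons.IH)
        qed
      qed
    qed auto
    then show ?thesis by (simp add: xs_def ys_def r_def add_ac)
  qed
qed simp

text \<open>
  The left side is the count for 213 and the right side the count for 123. After a row has been
  used, the state for 213 arises from that for 123 by merging the remainder of the block with the
  block of all lower rows.
\<close>

lemma block_count_le:
  "block_count (\<lambda>b. 0) bs c fs \<le> block_count (\<lambda>b. b - 1) bs c fs"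
proof (induction fs arbitrary: bs c)
  case (Cons f fs)
  define bs' where "bs' = bs @ replicate (c - f) 1"
  have "block_count (\<lambda>b. 0) (split_sizes (\<lambda>b. 0) bs' i) f fs \<le>
      block_count (\<lambda>b. b - 1) (split_sizes (\<lambda>b. b - 1) bs' i) f fs" if "bs' ! i \<noteq> 0" for i
  proof -
    have "block_count (\<lambda>b. 0) (split_sizes (\<lambda>b. 0) bs' i) f fs \<le>
        block_count (\<lambda>b. b - 1) (split_sizes (\<lambda>b. 0) bs' i) f fs" by (rule Cons.IH)
    also have "\<dots> \<le> block_count (\<lambda>b. b - 1) (split_sizes (\<lambda>b. b - 1) bs' i) f fs"
      using block_count_merge[of "take i bs'" "bs' ! i - 1" "sum_list (drop (Suc i) bs')" "[]"] that
      by (simp add: split_sizes_def)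
    finally show ?thesis .
  qed
  then show ?case
    unfolding block_count.simps bs'_def by (intro sum_mono) auto
qed simp


section \<open>The count for 321\<close>

text \<open>
  The number of ways to complete a transversal that avoids 321. After a row \<open>y\<close> has been used, all open rows above \<open>y\<close> have to come in decreasing
  order. So a state has a chain of \<open>k\<close> open rows at the top, of which only the highest may be used next,
  and \<open>m\<close> free rows below it. Using the free row with \<open>j\<close> free rows below it
  moves the free rows above it into the chain.
\<close>

fun chain_count :: "nat \<Rightarrow> nat \<Rightarrow> nat \<Rightarrow> nat list \<Rightarrow> nat" where
  "chain_count k m c [] = 1"
| "chain_count k m c (f # fs) =
     (if k = 0 then 0 else chain_count (k - 1) (m + (c - f)) f fs) +
     (\<Sum>j<m + (c - f). chain_count (k + (m + (c - f)) - 1 - j) j f fs)"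

lemma X_times_cheb_power:
  "X * (cheb k * X ^ m) = cheb (Suc (k + m)) +
     ((if k = 0 then 0 else cheb (k - 1) * X ^ m) + (\<Sum>j<m. cheb (k + m - 1 - j) * X ^ j))"
proof (induction m arbitrary: k)
  case 0
  then show ?case by (cases k) auto
next
  case (Suc m)
  have "X * (cheb k * X ^ Suc m) = X * ((X * cheb k) * X ^ m)" by (simp add: mult_ac)
  also have "X * cheb k = cheb (Suc k) + (if k = 0 then 0 else cheb (k - 1))"
    by (cases k) simp_all
  also have "X * ((cheb (Suc k) + (if k = 0 then 0 else cheb (k - 1))) * X ^ m) =
      X * (cheb (Suc k) * X ^ m) + (if k = 0 then 0 else cheb (k - 1) * X ^ Suc m)"
    by (simp add: algebra_simps)
  also have "X * (cheb (Suc k) * X ^ m) = cheb (Suc (Suc k + m)) +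
     (cheb k * X ^ m + (\<Sum>j<m. cheb (k + m - j) * X ^ j))"
    using Suc[of "Suc k"] by simp
  also have "cheb k * X ^ m + (\<Sum>j<m. cheb (k + m - j) * X ^ j) = (\<Sum>j<Suc m. cheb (k + Suc m - 1 - j) * X ^ j)"
    by simp
  finally show ?case by (simp add: algebra_simps)
qed

lemma degree_cheb_power: "degree (cheb k * X ^ m) = k + m"
  by (simp add: degree_mult_eq cheb_nonzero degree_cheb degree_power_eq)

lemma lead_coeff_cheb_power: "lead_coeff (cheb k * X ^ m) = 1"
  by (simp only: lead_coeff_mult lead_coeff_power lead_coeff_cheb) simp

lemma chain_count_eq_weight:
  "int (chain_count k m c fs) = weight (k + m) (cheb k * X ^ m) c fs"
proof (induction fs arbitrary: k m c)
  case Nil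
  show ?case using degree_cheb_power[of k m] lead_coeff_cheb_power[of k m] by simp
next
  case (Cons f fs)
  define M where "M = m + (c - f)"
  have "X ^ Suc (c - f) * (cheb k * X ^ m) = X * (cheb k * X ^ M)"
    by (simp add: M_def power_add mult_ac)
  also have "\<dots> = cheb (Suc (k + M)) +
      ((if k = 0 then 0 else cheb (k - 1) * X ^ M) + (\<Sum>j<M. cheb (k + M - 1 - j) * X ^ j))"
    by (rule X_times_cheb_power)
  finally have "weight (k + m) (cheb k * X ^ m) c (f # fs) = weight (k + M - 1)
      ((if k = 0 then 0 else cheb (k - 1) * X ^ M) + (\<Sum>j<M. cheb (k + M - 1 - j) * X ^ j)) f fs"
    using degree_cheb_power[of k m] lead_coeff_cheb_power[of k m] weight_Cons[of c f "cheb k * X ^ m" "k + m"]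
    by (simp only: M_def add.assoc)
  also have "\<dots> = (if k = 0 then 0 else weight (k + M - 1) (cheb (k - 1) * X ^ M) f fs) +
      (\<Sum>j<M. weight (k + M - 1) (cheb (k + M - 1 - j) * X ^ j) f fs)"
    by (simp add: weight_add weight_sum weight_0)
  also have "(if k = 0 then 0 else weight (k + M - 1) (cheb (k - 1) * X ^ M) f fs) =
      int (if k = 0 then 0 else chain_count (k - 1) M f fs)"
    using Cons[of "k - 1" M f] by (cases k) simp_all
  also have "(\<Sum>j<M. weight (k + M - 1) (cheb (k + M - 1 - j) * X ^ j) f fs) =
      (\<Sum>j<M. int (chain_count (k + M - 1 - j) j f fs))"
    by (intro sum.cong refl) (simp add: Cons)
  finally show ?case unfolding chain_count.simps M_def[symmetric] by simp
qed

text \<open>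
  Both counts start from the functional at the constant polynomial 1.
\<close>

lemma block_count_eq_chain_count:
  "block_count (\<lambda>b. b - 1) [] c fs = chain_count 0 0 c fs"
  using block_count_eq_weight[of "[]" c fs] chain_count_eq_weight[of 0 0 c fs]
  by (simp add: cheb_prod_simps)

text \<open>
  The rows that can play the two larger parts of 321, given that \<open>y\<close> plays the 1. The corner cell
  is the rightmost element itself, so the lowest admissible row \<open>f\<close> plays no role.
\<close>

definition above :: "nat \<Rightarrow> nat \<Rightarrow> nat \<Rightarrow> bool" where
  "above f y z \<longleftrightarrow> y < z"

text \<open>
  The completions of a state with chain \<open>K\<close> and free open rows \<open>F\<close>, where the rows below \<open>c\<close> are not
  open yet.
\<close>

definition chain_words :: "nat set \<Rightarrow> nat set \<Rightarrow> nat \<Rightarrow> nat list \<Rightarrow> nat list set" where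
  "chain_words K F c fs = {ys. distinct ys \<and> set ys = K \<union> F \<union> {1..<c} \<and> sweep above (>) fs ys \<and>
     sorted_wrt (>) (filter (\<lambda>z. z \<in> K) ys)}"

lemma finite_chain_words: "finite K \<Longrightarrow> finite F \<Longrightarrow> finite (chain_words K F c fs)"
  by (rule finite_subset[OF _ finite_subset_distinct[of "K \<union> F \<union> {1..<c}"]])
     (auto simp: chain_words_def)

lemma bij_betw_card_below:
  fixes F :: "nat set"
  assumes "finite F"
  shows "bij_betw (\<lambda>y. card {z \<in> F. z < y}) F {..<card F}"
proof -
  have less: "card {z \<in> F. z < x} < card {z \<in> F. z < y}" if "x \<in> F" "x < y" for x y
    using assms that by (intro psubset_card_mono) auto
  have inj: "inj_on (\<lambda>y. card {z \<in> F. z < y}) F"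
  proof (rule inj_onI)
    fix x y assume "x \<in> F" "y \<in> F" "card {z \<in> F. z < x} = card {z \<in> F. z < y}"
    then show "x = y" using less[of x y] less[of y x] by (metis less_irrefl nat_neq_iff)
  qed
  have "(\<lambda>y. card {z \<in> F. z < y}) ` F \<subseteq> {..<card F}"
  proof
    fix j assume "j \<in> (\<lambda>y. card {z \<in> F. z < y}) ` F"
    then obtain y where y: "y \<in> F" "j = card {z \<in> F. z < y}" by blast
    then have "{z \<in> F. z < y} \<subset> F" by blast
    then show "j \<in> {..<card F}" using assms psubset_card_mono y(2) by blast
  qed
  with inj have "(\<lambda>y. card {z \<in> F. z < y}) ` F = {..<card F}"
    by (intro card_subset_eq) (simp_all add: card_image)
  then show ?thesis using inj by (simp add: bij_betw_def)
qed

text \<open>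
  A completion starts with the highest row of the chain or with any free row.
\<close>

lemma chain_words_pick:
  assumes fin: "finite K" "finite F"
    and KF: "\<And>k z. k \<in> K \<Longrightarrow> z \<in> F \<Longrightarrow> z < k"
    and ge: "\<And>z. z \<in> K \<union> F \<Longrightarrow> f \<le> z"
  shows "chain_words K F f (f # fs) =
    (\<Union>y\<in>F \<union> (if K = {} then {} else {Max K}).
       Cons y ` (if y \<in> K then chain_words (K - {y}) F f fs
                 else chain_words (K \<union> {z \<in> F. y < z}) {z \<in> F. z < y} f fs))"
    (is "_ = (\<Union>y\<in>?H. Cons y ` ?X y)")
proof -
  have KFd: "K \<inter> F = {}" using KF by fastforce
  have iff: "y # ys \<in> chain_words K F f (f # fs) \<longleftrightarrow> y \<in> ?H \<and> ys \<in> ?X y" for y ys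
  proof (cases "y \<in> K")
    case True
    have max: "y = Max K" if "distinct (y # ys)" "insert y (set ys) = K \<union> F \<union> {1..<f}"
        "sorted_wrt (>) (filter (\<lambda>z. z \<in> K) (y # ys))"
    proof (rule Max_eqI[symmetric])
      fix k assume "k \<in> K"
      then have "k = y \<or> k \<in> set ys" using that(2) by auto
      then show "k \<le> y" using that(3) \<open>k \<in> K\<close> True by auto
    qed (use fin True in auto)
    show ?thesis
    proof
      assume "y # ys \<in> chain_words K F f (f # fs)"
      then have w: "distinct (y # ys)" "insert y (set ys) = K \<union> F \<union> {1..<f}"
        "sweep above (>) fs ys" "sorted_wrt (>) (filter (\<lambda>z. z \<in> K) (y # ys))"
        by (auto simp: chain_words_def)
      have "set ys = K \<union> F \<union> {1..<f} - {y}" using w(1) unfolding w(2)[symmetric] by auto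
      also have "\<dots> = (K - {y}) \<union> F \<union> {1..<f}" using True KFd ge[of y] by auto
      finally have "set ys = (K - {y}) \<union> F \<union> {1..<f}" .
      moreover have "sorted_wrt (>) (filter (\<lambda>z. z \<in> K - {y}) ys)"
        by (rule sorted_wrt_filter_subset[of _ "\<lambda>z. z \<in> K"]) (use w(4) True in auto)
      ultimately show "y \<in> ?H \<and> ys \<in> ?X y"
        using w True max[OF w(1,2,4)] by (auto simp: chain_words_def)
    next
      assume "y \<in> ?H \<and> ys \<in> ?X y"
      then have w: "y = Max K" "distinct ys" "set ys = (K - {y}) \<union> F \<union> {1..<f}"
        "sweep above (>) fs ys" "sorted_wrt (>) (filter (\<lambda>z. z \<in> K - {y}) ys)"
        using True KFd by (auto simp: chain_words_def split: if_splits)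
      have y_max: "z < y" if "z \<in> set ys" for z
      proof -
        have "z \<in> K - {y} \<Longrightarrow> z < y" using w(1) fin by (metis DiffE Max_ge insertCI le_neq_implies_less)
        then show ?thesis using that w(3) KF[OF True] ge[of y] True by auto
      qed
      then have y_notin: "y \<notin> set ys" by blast
      have "sorted_wrt (>) (filter (\<lambda>z. z \<in> K) ys)"
        by (rule sorted_wrt_filter_subset[OF w(5)]) (use y_notin in auto)
      moreover have empty: "filter (above f y) ys = []"
        using y_max by (fastforce simp: filter_empty_conv above_def)
      moreover have "set (y # ys) = K \<union> F \<union> {1..<f}" using w(3) True by auto
      ultimately show "y # ys \<in> chain_words K F f (f # fs)"
        using w(2,4) y_notin y_max True ge[of y] by (auto simp: chain_words_def)
    qed
  next
    case False
    let ?K = "K \<union> {z \<in> F. y < z}" and ?F = "{z \<in> F. z < y}"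
    show ?thesis
    proof
      assume "y # ys \<in> chain_words K F f (f # fs)"
      then have w: "distinct (y # ys)" "insert y (set ys) = K \<union> F \<union> {1..<f}" "f \<le> y"
        "sweep above (>) fs ys" "sorted_wrt (>) (filter (above f y) ys)"
        by (auto simp: chain_words_def)
      have "y \<in> K \<union> F \<union> {1..<f}" using w(2) by (metis insertI1)
      then have yF: "y \<in> F" using w(3) False by auto
      have "set ys = K \<union> F \<union> {1..<f} - {y}" using w(1) unfolding w(2)[symmetric] by auto
      also have "\<dots> = ?K \<union> ?F \<union> {1..<f}" using False yF w(3) by auto
      finally have "set ys = ?K \<union> ?F \<union> {1..<f}" .
      moreover have "sorted_wrt (>) (filter (\<lambda>z. z \<in> ?K) ys)"
        by (rule sorted_wrt_filter_subset[OF w(5)]) (use KF yF in \<open>auto simp: above_def\<close>)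
      ultimately have "ys \<in> chain_words ?K ?F f fs"
        using w by (simp add: chain_words_def)
      then show "y \<in> ?H \<and> ys \<in> ?X y" using False yF by simp
    next
      assume *: "y \<in> ?H \<and> ys \<in> ?X y"
      then have yF: "y \<in> F" using False Max_in[OF fin(1)] by (auto split: if_splits)
      have w: "distinct ys" "set ys = ?K \<union> ?F \<union> {1..<f}"
        "sweep above (>) fs ys" "sorted_wrt (>) (filter (\<lambda>z. z \<in> ?K) ys)"
        using * False by (auto simp: chain_words_def)
      have fy: "f \<le> y" using ge yF by auto
      have "sorted_wrt (>) (filter (above f y) ys)"
      proof (rule sorted_wrt_filter_subset[OF w(4)])
        fix z assume "z \<in> set ys" "above f y z"
        then have "z \<in> ?K \<union> ?F \<union> {1..<f}" "y < z" using w(2) by (simp_all add: above_def)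
        then show "z \<in> ?K" using fy by auto
      qed
      moreover have "sorted_wrt (>) (filter (\<lambda>z. z \<in> K) ys)"
        by (rule sorted_wrt_filter_subset[OF w(4)]) auto
      moreover have "y \<notin> set ys" using w(2) False fy by auto
      moreover have "K \<union> F = insert y (?K \<union> ?F)" using yF by (auto simp del: not_less dest: linorder_neqE)
      then have "set (y # ys) = K \<union> F \<union> {1..<f}" unfolding list.set w(2) by blast
      ultimately show "y # ys \<in> chain_words K F f (f # fs)"
        using w(1,3) fy False by (simp add: chain_words_def)
    qed
  qed
  show ?thesis
  proof (intro equalityI subsetI)
    fix w assume "w \<in> chain_words K F f (f # fs)"
    moreover from this obtain y ys where "w = y # ys" by (cases w) (auto simp: chain_words_def)
    ultimately show "w \<in> (\<Union>y\<in>?H. Cons y ` ?X y)" using iff by blast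
  next
    fix w assume "w \<in> (\<Union>y\<in>?H. Cons y ` ?X y)"
    then show "w \<in> chain_words K F f (f # fs)" using iff by blast
  qed
qed

theorem card_chain_words:
  assumes "finite K" "finite F" "\<forall>k\<in>K. \<forall>z\<in>F. z < k" "\<forall>z\<in>K \<union> F. c \<le> z"
    and "sorted_wrt (\<ge>) (c # fs)" "\<forall>f\<in>set fs. 1 \<le> f"
    and "card K + card F + c = Suc (length fs)" "1 \<le> c"
  shows "card (chain_words K F c fs) = chain_count (card K) (card F) c fs"
  using assms
proof (induction fs arbitrary: K F c)
  case Nil
  then have "card K + card F + c = 1" "1 \<le> c" by simp_all
  then have "card K = 0" "card F = 0" "c = 1" by linarith+
  then have "K = {}" "F = {}" "c = 1" using Nil(1,2) by (simp_all only: card_0_eq)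
  then have "chain_words K F c [] = {[]}" by (auto simp: chain_words_def)
  then show ?case by simp
next
  case (Cons f fs)
  then have fc: "f \<le> c" "1 \<le> f" by auto
  define F' where "F' = F \<union> {f..<c}"
  have fin: "finite K" "finite F'" using Cons.prems by (auto simp: F'_def)
  have KF: "\<And>k z. k \<in> K \<Longrightarrow> z \<in> F' \<Longrightarrow> z < k" and ge: "\<And>z. z \<in> K \<union> F' \<Longrightarrow> f \<le> z"
  proof -
    fix k z assume "k \<in> K" "z \<in> F'"
    then show "z < k" using Cons.prems(3,4) unfolding F'_def by (metis UnCI UnE atLeastLessThan_iff order.strict_trans2)
  next
    fix z assume "z \<in> K \<union> F'"
    then have "c \<le> z \<or> f \<le> z" using Cons.prems(4) unfolding F'_def by (metis UnCI UnE atLeastLessThan_iff)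
    then show "f \<le> z" using fc by linarith
  qed
  have cardF': "card F' = card F + (c - f)"
  proof -
    have "F \<inter> {f..<c} = {}"
    proof (intro equals0I, elim IntE)
      fix z assume "z \<in> F" "z \<in> {f..<c}"
      then show False using Cons.prems(4)[rule_format, of z] by simp
    qed
    then show ?thesis unfolding F'_def using Cons.prems(2) by (simp add: card_Un_disjoint)
  qed
  have len: "card K + card F' + f = Suc (Suc (length fs))"
    using Cons.prems(7) fc cardF' by simp
  define H where "H = F' \<union> (if K = {} then {} else {Max K})"
  define W where "W = (\<lambda>y. if y \<in> K then chain_words (K - {y}) F' f fs
                 else chain_words (K \<union> {z \<in> F'. y < z}) {z \<in> F'. z < y} f fs)"
  have "K \<union> F \<union> {1..<c} = K \<union> F' \<union> {1..<f}" using fc by (auto simp: F'_def)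
  then have "chain_words K F c (f # fs) = chain_words K F' f (f # fs)"
    by (simp add: chain_words_def)
  also have "\<dots> = (\<Union>y\<in>H. Cons y ` W y)"
    unfolding H_def W_def by (rule chain_words_pick[OF fin KF ge])
  also have "card \<dots> = (\<Sum>y\<in>H. card (W y))"
    using fin by (intro card_UN_Cons) (auto simp: H_def W_def intro!: finite_chain_words)
  also have "\<dots> = (if K = {} then 0 else card (W (Max K))) + (\<Sum>y\<in>F'. card (W y))"
  proof (cases "K = {}")
    case False
    then have "Max K \<notin> F'" using KF[of "Max K" "Max K"] fin by auto
    then show ?thesis using False fin by (simp add: H_def)
  qed (simp add: H_def)
  also have "(if K = {} then 0 else card (W (Max K))) =
      (if card K = 0 then 0 else chain_count (card K - 1) (card F') f fs)"
  proof (cases "K = {}")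
    case False
    then have mem: "Max K \<in> K" and pos: "card K \<noteq> 0" using fin by auto
    have bal: "card (K - {Max K}) + card F' + f = Suc (length fs)"
      using len pos mem fin by (simp only: card_Diff_singleton)
    have "\<forall>z\<in>K - {Max K} \<union> F'. f \<le> z" using ge by blast
    then have "card (chain_words (K - {Max K}) F' f fs) = chain_count (card (K - {Max K})) (card F') f fs"
      using Cons.IH[OF _ _ _ _ _ _ bal] fin KF fc Cons.prems(5,6) by simp
    with mem pos show ?thesis using False fin by (simp add: W_def card_Diff_singleton)
  qed simp
  also have "(\<Sum>y\<in>F'. card (W y)) =
      (\<Sum>y\<in>F'. chain_count (card K + card F' - 1 - card {z \<in> F'. z < y}) (card {z \<in> F'. z < y}) f fs)"
  proof (rule sum.cong[OF refl])
    fix y assume y: "y \<in> F'"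
    then have yK: "y \<notin> K" using KF by fastforce
    have "F' = insert y ({z \<in> F'. z < y} \<union> {z \<in> F'. y < z})" using y by auto
    also have "card \<dots> = Suc (card {z \<in> F'. z < y} + card {z \<in> F'. y < z})"
      using fin by (subst card_insert_disjoint) (auto intro!: card_Un_disjoint)
    finally have F'y: "card F' = Suc (card {z \<in> F'. z < y} + card {z \<in> F'. y < z})" .
    moreover have "card (K \<union> {z \<in> F'. y < z}) = card K + card {z \<in> F'. y < z}"
      using fin KF by (intro card_Un_disjoint) fastforce+
    ultimately have K': "card (K \<union> {z \<in> F'. y < z}) = card K + card F' - 1 - card {z \<in> F'. z < y}"
      and bal: "card (K \<union> {z \<in> F'. y < z}) + card {z \<in> F'. z < y} + f = Suc (length fs)"
      using len by auto
    have "\<forall>k\<in>K \<union> {z \<in> F'. y < z}. \<forall>z\<in>{z \<in> F'. z < y}. z < k"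
    proof (intro ballI)
      fix k z assume "k \<in> K \<union> {z \<in> F'. y < z}" "z \<in> {z \<in> F'. z < y}"
      then show "z < k" using KF[of k z] less_trans[of z y k] by blast
    qed
    moreover have "\<forall>z\<in>K \<union> {z \<in> F'. y < z} \<union> {z \<in> F'. z < y}. f \<le> z" using ge by blast
    ultimately have "card (chain_words (K \<union> {z \<in> F'. y < z}) {z \<in> F'. z < y} f fs) =
        chain_count (card (K \<union> {z \<in> F'. y < z})) (card {z \<in> F'. z < y}) f fs"
      by (rule Cons.IH[OF _ _ _ _ _ _ bal fc(2), rotated 2]) (use fin Cons.prems(5,6) in auto)
    then show "card (W y) = chain_count (card K + card F' - 1 - card {z \<in> F'. z < y})
        (card {z \<in> F'. z < y}) f fs"
      unfolding W_def K' using yK by simp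
  qed
  also have "\<dots> = (\<Sum>j<card F'. chain_count (card K + card F' - 1 - j) j f fs)"
    by (rule sum.reindex_bij_betw[OF bij_betw_card_below[OF fin(2)]])
  finally show ?case by (simp only: chain_count.simps cardF')
qed

section \<open>Transversals as words\<close>

lemma contains_in_3:
  "contains_in Y T [a, b, c] \<longleftrightarrow>
     (\<exists>x1 x2 x3 y1 y2 y3. x1 < x2 \<and> x2 < x3 \<and> (x1, y1) \<in> T \<and> (x2, y2) \<in> T \<and> (x3, y3) \<in> T \<and>
        (y1 < y2 \<longleftrightarrow> a < b) \<and> (y2 < y1 \<longleftrightarrow> b < a) \<and> (y1 < y3 \<longleftrightarrow> a < c) \<and> (y3 < y1 \<longleftrightarrow> c < a) \<and>
        (y2 < y3 \<longleftrightarrow> b < c) \<and> (y3 < y2 \<longleftrightarrow> c < b) \<and> (x3, min y1 (min y2 y3)) \<in> cells Y)"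
    (is "?L \<longleftrightarrow> ?R")
proof
  assume ?L
  then obtain xs ys where *: "length xs = 3" "length ys = 3" "sorted_wrt (<) xs"
     "\<forall>i<3. (xs ! i, ys ! i) \<in> T"
     "\<forall>i<3. \<forall>j<3. ys ! i < ys ! j \<longleftrightarrow> [a, b, c] ! i < [a, b, c] ! j"
     "(last xs, Min (set ys)) \<in> cells Y"
    unfolding contains_in_def by (auto simp: numeral_3_eq_3)
  from *(1,2) obtain x1 x2 x3 y1 y2 y3 where xs: "xs = [x1, x2, x3]" and ys: "ys = [y1, y2, y3]"
    by (auto simp: numeral_3_eq_3 length_Suc_conv)
  have "x1 < x2" "x2 < x3" using *(3) by (simp_all add: xs)
  moreover have "(x1, y1) \<in> T" "(x2, y2) \<in> T" "(x3, y3) \<in> T"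
    using *(4)[rule_format, of 0] *(4)[rule_format, of 1] *(4)[rule_format, of 2] by (simp_all add: xs ys)
  moreover have "y1 < y2 \<longleftrightarrow> a < b" "y2 < y1 \<longleftrightarrow> b < a" "y1 < y3 \<longleftrightarrow> a < c" "y3 < y1 \<longleftrightarrow> c < a"
    "y2 < y3 \<longleftrightarrow> b < c" "y3 < y2 \<longleftrightarrow> c < b"
    using *(5)[rule_format, of 0 1] *(5)[rule_format, of 1 0] *(5)[rule_format, of 0 2]
      *(5)[rule_format, of 2 0] *(5)[rule_format, of 1 2] *(5)[rule_format, of 2 1] by (simp_all add: ys)
  moreover have "(x3, min y1 (min y2 y3)) \<in> cells Y" using *(6) by (simp add: xs ys)
  ultimately show ?R by blast
next
  assume ?R
  then show ?L
  proof (elim exE conjE)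
    fix x1 x2 x3 y1 y2 y3
    assume *: "x1 < x2" "x2 < x3" "(x1, y1) \<in> T" "(x2, y2) \<in> T" "(x3, y3) \<in> T"
      "y1 < y2 \<longleftrightarrow> a < b" "y2 < y1 \<longleftrightarrow> b < a" "y1 < y3 \<longleftrightarrow> a < c" "y3 < y1 \<longleftrightarrow> c < a"
      "y2 < y3 \<longleftrightarrow> b < c" "y3 < y2 \<longleftrightarrow> c < b" "(x3, min y1 (min y2 y3)) \<in> cells Y"
    have "\<forall>i<length [a, b, c]. ([x1, x2, x3] ! i, [y1, y2, y3] ! i) \<in> T"
      using *(3-5) by (simp add: All_less_Suc numeral_2_eq_2)
    moreover have "\<forall>i<length [a, b, c]. \<forall>j<length [a, b, c].
        [y1, y2, y3] ! i < [y1, y2, y3] ! j \<longleftrightarrow> [a, b, c] ! i < [a, b, c] ! j"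
      using *(6-11) by (simp add: All_less_Suc numeral_2_eq_2)
    ultimately show ?L
      unfolding contains_in_def using *(1,2,12)
      by (intro exI[of _ "[x1, x2, x3]"] exI[of _ "[y1, y2, y3]"] conjI) simp_all
  qed
qed

text \<open>
  The lowest cell of a column; the cells of a proper diagram above it fill the column up to the top.
\<close>

definition column_floor :: "nat list \<Rightarrow> nat \<Rightarrow> nat" where
  "column_floor Y x = (LEAST y. (x, y) \<in> cells Y)"

lemma cells_mono:
  assumes "proper Y" "(x, y) \<in> cells Y" "1 \<le> x'" "x' \<le> x" "y \<le> y'" "y' \<le> length Y"
  shows "(x', y') \<in> cells Y"
proof -
  have y: "1 \<le> y" "y \<le> length Y" "x \<le> Y ! (length Y - y)" using assms(2) by (auto simp: cells_def)
  have "Y ! (length Y - y) \<le> Y ! (length Y - y')"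
  proof (cases "y = y'")
    case False
    have "sorted_wrt (\<ge>) Y" using assms(1) by (simp add: proper_def young_diagram_def)
    then show ?thesis using sorted_wrt_nth_less[of "(\<ge>)" Y "length Y - y'" "length Y - y"] assms y False by simp
  qed simp
  then show ?thesis using y assms by (auto simp: cells_def)
qed

lemma cells_iff:
  assumes "proper Y"
  shows "(x, y) \<in> cells Y \<longleftrightarrow> 1 \<le> x \<and> x \<le> length Y \<and> column_floor Y x \<le> y \<and> y \<le> length Y"
proof
  assume *: "(x, y) \<in> cells Y"
  then have "x \<in> {1..length Y}" using assms unfolding proper_def by (metis fst_conv image_eqI)
  then show "1 \<le> x \<and> x \<le> length Y \<and> column_floor Y x \<le> y \<and> y \<le> length Y"
    using * by (auto simp: cells_def column_floor_def intro: Least_le)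
next
  assume *: "1 \<le> x \<and> x \<le> length Y \<and> column_floor Y x \<le> y \<and> y \<le> length Y"
  then have "x \<in> fst ` cells Y" using assms by (simp add: proper_def)
  then obtain y' where "(x, y') \<in> cells Y" by auto
  then have "(x, column_floor Y x) \<in> cells Y" unfolding column_floor_def by (rule LeastI)
  then show "(x, y) \<in> cells Y" using cells_mono[OF assms] * by blast
qed

lemma column_floor_cell:
  assumes "proper Y" "1 \<le> x" "x \<le> length Y"
  shows "(x, column_floor Y x) \<in> cells Y"
proof -
  have "x \<in> fst ` cells Y" using assms by (simp add: proper_def)
  then obtain y' where "(x, y') \<in> cells Y" by auto
  then show ?thesis unfolding column_floor_def by (rule LeastI)
qed

lemma column_floor_mono:
  assumes "proper Y" "1 \<le> x" "x \<le> x'" "x' \<le> length Y"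
  shows "column_floor Y x \<le> column_floor Y x'"
proof -
  have "(x', column_floor Y x') \<in> cells Y" using column_floor_cell assms by auto
  then have "(x, column_floor Y x') \<in> cells Y"
    using cells_mono[OF assms(1)] assms(2,3) by (auto simp: cells_def)
  then show ?thesis by (simp add: cells_iff[OF assms(1)])
qed

text \<open>
  The lowest cells of the columns, from right to left.
\<close>

definition floors :: "nat list \<Rightarrow> nat list" where
  "floors Y = map (column_floor Y) (rev [1..<Suc (length Y)])"

lemma length_floors: "length (floors Y) = length Y"
  by (simp add: floors_def del: upt_Suc)

lemma nth_floors: "i < length Y \<Longrightarrow> floors Y ! i = column_floor Y (length Y - i)"
  by (simp add: floors_def rev_nth Suc_diff_Suc del: upt_Suc)

lemma floors_range:
  assumes "proper Y"
  shows "sorted_wrt (\<ge>) (Suc (length Y) # floors Y)" "\<forall>f\<in>set (floors Y). 1 \<le> f"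
proof -
  have b: "1 \<le> column_floor Y x \<and> column_floor Y x \<le> length Y" if "1 \<le> x" "x \<le> length Y" for x
    using column_floor_cell[OF assms that] by (auto simp: cells_def)
  have set: "set (floors Y) = column_floor Y ` {1..length Y}"
    by (simp add: floors_def atLeastLessThanSuc_atLeastAtMost del: upt_Suc)
  show "\<forall>f\<in>set (floors Y). 1 \<le> f" unfolding set using b by simp
  have "sorted_wrt (\<ge>) (floors Y)"
    unfolding sorted_wrt_iff_nth_less length_floors
  proof (intro allI impI)
    fix i j assume "i < j" "j < length Y"
    then show "floors Y ! i \<ge> floors Y ! j"
      by (simp add: nth_floors column_floor_mono[OF assms])
  qed
  then show "sorted_wrt (\<ge>) (Suc (length Y) # floors Y)"
    unfolding sorted_wrt.simps set using b by (simp add: le_SucI)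
qed

text \<open>
  The set of cells encoded by a word of rows, whose first letter belongs to the rightmost column.
\<close>

definition rooks :: "nat list \<Rightarrow> (nat \<times> nat) set" where
  "rooks ys = {(x, y). 1 \<le> x \<and> x \<le> length ys \<and> y = ys ! (length ys - x)}"

lemma rooks_iff: "(x, y) \<in> rooks ys \<longleftrightarrow> 1 \<le> x \<and> x \<le> length ys \<and> y = ys ! (length ys - x)"
  by (simp add: rooks_def)

lemma inj_on_rooks: "inj_on rooks {ys. length ys = n}"
proof (rule inj_onI, rule nth_equalityI)
  fix xs ys :: "nat list"
  assume *: "xs \<in> {ys. length ys = n}" "ys \<in> {ys. length ys = n}" "rooks xs = rooks ys"
  show "length xs = length ys" using * by simp
  fix i assume "i < length xs"
  then have i: "n - (n - i) = i" "1 \<le> n - i" "length xs = n" "length ys = n" using * by auto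
  then have "(n - i, xs ! i) \<in> rooks xs" by (simp add: rooks_iff)
  then have "(n - i, xs ! i) \<in> rooks ys" using * by simp
  then show "xs ! i = ys ! i" by (simp add: rooks_iff i)
qed

lemma transversalsD:
  assumes "T \<in> transversals Y" "proper Y"
  shows "(x, y) \<in> T \<Longrightarrow> 1 \<le> x \<and> x \<le> length Y \<and> 1 \<le> y \<and> y \<le> length Y \<and> (x, y) \<in> cells Y"
    "(x, y) \<in> T \<Longrightarrow> (x, y') \<in> T \<Longrightarrow> y = y'"
    "(x, y) \<in> T \<Longrightarrow> (x', y) \<in> T \<Longrightarrow> x = x'"
    "1 \<le> x \<Longrightarrow> x \<le> length Y \<Longrightarrow> \<exists>y. (x, y) \<in> T"
    "1 \<le> y \<Longrightarrow> y \<le> length Y \<Longrightarrow> \<exists>x. (x, y) \<in> T"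
proof -
  have T: "T \<subseteq> cells Y" "\<forall>x\<in>{1..length Y}. \<exists>!y. (x, y) \<in> T" "\<forall>y\<in>{1..length Y}. \<exists>!x. (x, y) \<in> T"
    using assms(1) by (auto simp: transversals_def)
  show range: "(x, y) \<in> T \<Longrightarrow> 1 \<le> x \<and> x \<le> length Y \<and> 1 \<le> y \<and> y \<le> length Y \<and> (x, y) \<in> cells Y" for x y
    using T(1) cells_iff[OF assms(2), of x y] by (auto simp: cells_def)
  show "(x, y) \<in> T \<Longrightarrow> (x, y') \<in> T \<Longrightarrow> y = y'"
    using T(2) range[of x y] by (metis atLeastAtMost_iff)
  show "(x, y) \<in> T \<Longrightarrow> (x', y) \<in> T \<Longrightarrow> x = x'"
    using T(3) range[of x y] by (metis atLeastAtMost_iff)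
qed (use assms(1) in \<open>auto simp: transversals_def\<close>)

lemma transversals_eq_rooks:
  assumes "proper Y"
  shows "transversals Y = rooks ` {ys. distinct ys \<and> set ys = {1..length Y} \<and>
    (\<forall>i<length Y. floors Y ! i \<le> ys ! i)}" (is "_ = rooks ` ?W")
proof (intro equalityI subsetI)
  fix T assume T: "T \<in> transversals Y"
  note tr = transversalsD[OF T assms]
  define h where "h = (\<lambda>x. THE y. (x, y) \<in> T)"
  have h: "(x, y) \<in> T \<longleftrightarrow> 1 \<le> x \<and> x \<le> length Y \<and> y = h x" for x y
  proof -
    have "h x = y" if "(x, y) \<in> T" for x y
      unfolding h_def using that tr(2) by blast
    then show ?thesis using tr(1,4) by blast
  qed
  define ys where "ys = map h (rev [1..<Suc (length Y)])"
  have nth: "ys ! i = h (length Y - i)" if "i < length Y" for i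
    using that by (simp add: ys_def rev_nth Suc_diff_Suc del: upt_Suc)
  have len: "length ys = length Y" by (simp add: ys_def del: upt_Suc)
  have "inj_on h {1..length Y}"
    by (rule inj_onI, rule tr(3)) (auto simp: h)
  then have "distinct ys" by (auto simp: ys_def distinct_map atLeastLessThanSuc_atLeastAtMost simp del: upt_Suc)
  moreover have "set ys = {1..length Y}"
  proof -
    have "set ys = h ` {1..length Y}"
      by (simp add: ys_def atLeastLessThanSuc_atLeastAtMost del: upt_Suc)
    moreover have "h ` {1..length Y} = {1..length Y}"
    proof (intro equalityI subsetI)
      fix y assume "y \<in> h ` {1..length Y}"
      then obtain x where "(x, y) \<in> T" using h by auto
      then show "y \<in> {1..length Y}" using tr(1) by auto
    next
      fix y assume "y \<in> {1..length Y}"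
      then obtain x where "(x, y) \<in> T" using tr(5) by auto
      then show "y \<in> h ` {1..length Y}" using h by auto
    qed
    ultimately show ?thesis by simp
  qed
  moreover have "floors Y ! i \<le> ys ! i" if "i < length Y" for i
  proof -
    have "(length Y - i, ys ! i) \<in> T" using that by (simp add: h nth)
    then show ?thesis using tr(1) that cells_iff[OF assms] by (simp add: nth_floors)
  qed
  moreover have "T = rooks ys"
    by (auto simp: h rooks_iff len nth)
  ultimately show "T \<in> rooks ` ?W" by blast
next
  fix T assume "T \<in> rooks ` ?W"
  then obtain ys where T: "T = rooks ys" and ys: "distinct ys" "set ys = {1..length Y}"
      "\<forall>i<length Y. floors Y ! i \<le> ys ! i" by auto
  have len: "length ys = length Y" using distinct_card[OF ys(1)] ys(2) by simp
  have mem: "ys ! i \<in> {1..length Y}" if "i < length Y" for i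
    using ys(2) that len nth_mem by metis
  have "T \<subseteq> cells Y"
  proof
    fix p assume "p \<in> T"
    then obtain x where x: "p = (x, ys ! (length Y - x))" "1 \<le> x" "x \<le> length Y"
      by (auto simp: T rooks_def len)
    then have "floors Y ! (length Y - x) \<le> ys ! (length Y - x)" using ys(3) by auto
    then show "p \<in> cells Y"
      using x mem[of "length Y - x"] by (simp add: cells_iff[OF assms] nth_floors)
  qed
  moreover have "T = (\<lambda>x. (x, ys ! (length Y - x))) ` {1..length Y}"
    by (auto simp: T rooks_def len)
  then have "card T = length Y" by (simp add: card_image inj_on_def)
  moreover have "\<exists>!x. (x, y) \<in> T" if "y \<in> {1..length Y}" for y
  proof -
    have "y \<in> set ys" using that ys(2) by simp
    then obtain i where i: "i < length Y" "y = ys ! i"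
      unfolding in_set_conv_nth len by blast
    show ?thesis
    proof (rule ex1I)
      show "(length Y - i, y) \<in> T" using i by (simp add: T rooks_iff len Suc_le_eq)
    next
      fix x assume "(x, y) \<in> T"
      then have "1 \<le> x" "x \<le> length Y" "ys ! (length Y - x) = ys ! i" using i by (auto simp: T rooks_iff len)
      then have "length Y - x = i" using nth_eq_iff_index_eq[OF ys(1), of "length Y - x" i] i len by simp
      then show "x = length Y - i" using \<open>x \<le> length Y\<close> by simp
    qed
  qed
  ultimately show "T \<in> transversals Y"
    by (auto simp: transversals_def T rooks_iff len)
qed

lemma card_avoiders_eq_sweep:
  assumes "proper Y"
    and pattern: "\<And>T. T \<in> transversals Y \<Longrightarrow> contains_in Y T \<tau> \<longleftrightarrow>
      (\<exists>x1 x2 x3 y1 y2 y3. x1 < x2 \<and> x2 < x3 \<and> (x1, y1) \<in> T \<and> (x2, y2) \<in> T \<and> (x3, y3) \<in> T \<and>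
        S (column_floor Y x3) y3 y2 \<and> S (column_floor Y x3) y3 y1 \<and> \<not> Q y2 y1)"
  shows "card (avoiders Y \<tau>) =
    card {ys. distinct ys \<and> set ys = {1..length Y} \<and> sweep S Q (floors Y) ys}"
proof -
  let ?n = "length Y"
  have avoid: "\<not> contains_in Y (rooks ys) \<tau> \<longleftrightarrow>
     (\<forall>i j k. i < j \<longrightarrow> j < k \<longrightarrow> k < ?n \<longrightarrow>
        S (floors Y ! i) (ys ! i) (ys ! j) \<longrightarrow> S (floors Y ! i) (ys ! i) (ys ! k) \<longrightarrow> Q (ys ! j) (ys ! k))"
    (is "?L \<longleftrightarrow> ?R")
    if T: "rooks ys \<in> transversals Y" and len: "length ys = ?n" for ys
  proof
    assume L: ?L
    show ?R
    proof (intro allI impI, rule ccontr)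
      fix i j k assume ijk: "i < j" "j < k" "k < ?n" "S (floors Y ! i) (ys ! i) (ys ! j)"
        "S (floors Y ! i) (ys ! i) (ys ! k)" "\<not> Q (ys ! j) (ys ! k)"
      have "?n - k < ?n - j" "?n - j < ?n - i" "1 \<le> ?n - k" "1 \<le> ?n - j" "1 \<le> ?n - i"
        using ijk(1-3) by linarith+
      moreover have "(?n - i, ys ! i) \<in> rooks ys" "(?n - j, ys ! j) \<in> rooks ys" "(?n - k, ys ! k) \<in> rooks ys"
        using ijk(1-3) by (auto simp: rooks_iff len)
      moreover have "floors Y ! i = column_floor Y (?n - i)" using ijk(1-3) by (simp add: nth_floors)
      ultimately have "contains_in Y (rooks ys) \<tau>"
        unfolding pattern[OF T] using ijk(4-6) by metis
      then show False using L by simp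
    qed
  next
    assume R: ?R
    show ?L
    proof
      assume "contains_in Y (rooks ys) \<tau>"
      then obtain x1 x2 x3 y1 y2 y3 where x: "x1 < x2" "x2 < x3" "(x1, y1) \<in> rooks ys"
         "(x2, y2) \<in> rooks ys" "(x3, y3) \<in> rooks ys" "S (column_floor Y x3) y3 y2"
         "S (column_floor Y x3) y3 y1" "\<not> Q y2 y1"
        unfolding pattern[OF T] by blast
      then have "?n - x3 < ?n - x2" "?n - x2 < ?n - x1" "?n - x1 < ?n"
        "floors Y ! (?n - x3) = column_floor Y x3"
        by (auto simp: rooks_iff len nth_floors)
      then show False
        using R[rule_format, of "?n - x3" "?n - x2" "?n - x1"] x by (simp add: rooks_iff len)
    qed
  qed
  have len: "length ys = ?n" if "distinct ys" "set ys = {1..?n}" for ys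
    using that distinct_card by fastforce
  have "avoiders Y \<tau> = rooks ` {ys. distinct ys \<and> set ys = {1..?n} \<and> sweep S Q (floors Y) ys}"
  proof (intro equalityI subsetI)
    fix T assume "T \<in> avoiders Y \<tau>"
    then have T: "T \<in> transversals Y" "\<not> contains_in Y T \<tau>" by (auto simp: avoiders_def)
    then obtain ys where ys: "T = rooks ys" "distinct ys" "set ys = {1..?n}" "\<forall>i<?n. floors Y ! i \<le> ys ! i"
      unfolding transversals_eq_rooks[OF assms(1)] by auto
    then have "sweep S Q (floors Y) ys"
      using avoid[of ys] T len[of ys] unfolding sweep_iff_nth length_floors by simp
    then show "T \<in> rooks ` {ys. distinct ys \<and> set ys = {1..?n} \<and> sweep S Q (floors Y) ys}"
      using ys by blast
  next
    fix T assume "T \<in> rooks ` {ys. distinct ys \<and> set ys = {1..?n} \<and> sweep S Q (floors Y) ys}"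
    then obtain ys where ys: "T = rooks ys" "distinct ys" "set ys = {1..?n}" "sweep S Q (floors Y) ys"
      by blast
    then have "T \<in> transversals Y"
      unfolding transversals_eq_rooks[OF assms(1)] sweep_iff_nth length_floors by blast
    then show "T \<in> avoiders Y \<tau>"
      using avoid[of ys] len[of ys] ys unfolding avoiders_def sweep_iff_nth length_floors by simp
  qed
  moreover have "inj_on rooks {ys. distinct ys \<and> set ys = {1..?n} \<and> sweep S Q (floors Y) ys}"
    by (rule inj_on_subset[OF inj_on_rooks[of ?n]]) (use len in auto)
  ultimately show ?thesis by (simp add: card_image)
qed

lemma transversal_cell_iff:
  assumes "proper Y" "T \<in> transversals Y" "(x, y) \<in> T" "(x', y') \<in> T"
  shows "(x', y) \<in> cells Y \<longleftrightarrow> column_floor Y x' \<le> y"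
  using transversalsD(1)[OF assms(2,1)] assms(3,4) by (auto simp: cells_iff[OF assms(1)])

lemma card_avoiders_123:
  assumes "proper Y"
  shows "card (avoiders Y [1, 2, 3]) = block_count (\<lambda>b. b - 1) [] (Suc (length Y)) (floors Y)"
proof -
  have "card (avoiders Y [1, 2, 3]) =
      card {ys. distinct ys \<and> set ys = {1..length Y} \<and> sweep below (<) (floors Y) ys}"
  proof (rule card_avoiders_eq_sweep[OF assms])
    fix T assume T: "T \<in> transversals Y"
    show "contains_in Y T [1, 2, 3] \<longleftrightarrow>
      (\<exists>x1 x2 x3 y1 y2 y3. x1 < x2 \<and> x2 < x3 \<and> (x1, y1) \<in> T \<and> (x2, y2) \<in> T \<and> (x3, y3) \<in> T \<and>
        below (column_floor Y x3) y3 y2 \<and> below (column_floor Y x3) y3 y1 \<and> \<not> y2 < y1)"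
      unfolding contains_in_3
    proof (intro ex_cong1 iffI)
      fix x1 x2 x3 y1 y2 y3
      assume *: "x1 < x2 \<and> x2 < x3 \<and> (x1, y1) \<in> T \<and> (x2, y2) \<in> T \<and> (x3, y3) \<in> T \<and>
        below (column_floor Y x3) y3 y2 \<and> below (column_floor Y x3) y3 y1 \<and> \<not> y2 < y1"
      then have "y1 \<noteq> y2" using transversalsD(3)[OF T assms, of x1 y1 x2] by auto
      then have "y1 < y2" "min y1 (min y2 y3) = y1" using * by (auto simp: below_def)
      then show "x1 < x2 \<and> x2 < x3 \<and> (x1, y1) \<in> T \<and> (x2, y2) \<in> T \<and> (x3, y3) \<in> T \<and>
        (y1 < y2 \<longleftrightarrow> (1::nat) < 2) \<and> (y2 < y1 \<longleftrightarrow> (2::nat) < 1) \<and> (y1 < y3 \<longleftrightarrow> (1::nat) < 3) \<and>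
        (y3 < y1 \<longleftrightarrow> (3::nat) < 1) \<and> (y2 < y3 \<longleftrightarrow> (2::nat) < 3) \<and> (y3 < y2 \<longleftrightarrow> (3::nat) < 2) \<and>
        (x3, min y1 (min y2 y3)) \<in> cells Y"
        using * transversal_cell_iff[OF assms T, of x1 y1 x3 y3] by (auto simp: below_def)
    next
      fix x1 x2 x3 y1 y2 y3
      assume *: "x1 < x2 \<and> x2 < x3 \<and> (x1, y1) \<in> T \<and> (x2, y2) \<in> T \<and> (x3, y3) \<in> T \<and>
        (y1 < y2 \<longleftrightarrow> (1::nat) < 2) \<and> (y2 < y1 \<longleftrightarrow> (2::nat) < 1) \<and> (y1 < y3 \<longleftrightarrow> (1::nat) < 3) \<and>
        (y3 < y1 \<longleftrightarrow> (3::nat) < 1) \<and> (y2 < y3 \<longleftrightarrow> (2::nat) < 3) \<and> (y3 < y2 \<longleftrightarrow> (3::nat) < 2) \<and>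
        (x3, min y1 (min y2 y3)) \<in> cells Y"
      then have "min y1 (min y2 y3) = y1" by auto
      then show "x1 < x2 \<and> x2 < x3 \<and> (x1, y1) \<in> T \<and> (x2, y2) \<in> T \<and> (x3, y3) \<in> T \<and>
        below (column_floor Y x3) y3 y2 \<and> below (column_floor Y x3) y3 y1 \<and> \<not> y2 < y1"
        using * transversal_cell_iff[OF assms T, of x1 y1 x3 y3] by (auto simp: below_def)
    qed
  qed
  also have "{ys. distinct ys \<and> set ys = {1..length Y} \<and> sweep below (<) (floors Y) ys} =
      ascending.words [] (Suc (length Y)) (floors Y)"
    by (simp add: ascending.words_def atLeastLessThanSuc_atLeastAtMost)
  also have "card \<dots> = block_count (\<lambda>b. b - 1) [] (Suc (length Y)) (floors Y)"
    using ascending.card_words[of "Suc (length Y)" "[]" "floors Y"] floors_range[OF assms]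
    by (simp add: decreasing_blocks_def length_floors)
  finally show ?thesis .
qed

lemma card_avoiders_213:
  assumes "proper Y"
  shows "card (avoiders Y [2, 1, 3]) = block_count (\<lambda>b. 0) [] (Suc (length Y)) (floors Y)"
proof -
  have "card (avoiders Y [2, 1, 3]) =
      card {ys. distinct ys \<and> set ys = {1..length Y} \<and> sweep below (>) (floors Y) ys}"
  proof (rule card_avoiders_eq_sweep[OF assms])
    fix T assume T: "T \<in> transversals Y"
    show "contains_in Y T [2, 1, 3] \<longleftrightarrow>
      (\<exists>x1 x2 x3 y1 y2 y3. x1 < x2 \<and> x2 < x3 \<and> (x1, y1) \<in> T \<and> (x2, y2) \<in> T \<and> (x3, y3) \<in> T \<and>
        below (column_floor Y x3) y3 y2 \<and> below (column_floor Y x3) y3 y1 \<and> \<not> y2 > y1)"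
      unfolding contains_in_3
    proof (intro ex_cong1 iffI)
      fix x1 x2 x3 y1 y2 y3
      assume *: "x1 < x2 \<and> x2 < x3 \<and> (x1, y1) \<in> T \<and> (x2, y2) \<in> T \<and> (x3, y3) \<in> T \<and>
        below (column_floor Y x3) y3 y2 \<and> below (column_floor Y x3) y3 y1 \<and> \<not> y2 > y1"
      then have "y1 \<noteq> y2" using transversalsD(3)[OF T assms, of x1 y1 x2] by auto
      then have "y2 < y1" "min y1 (min y2 y3) = y2" using * by (auto simp: below_def)
      then show "x1 < x2 \<and> x2 < x3 \<and> (x1, y1) \<in> T \<and> (x2, y2) \<in> T \<and> (x3, y3) \<in> T \<and>
        (y1 < y2 \<longleftrightarrow> (2::nat) < 1) \<and> (y2 < y1 \<longleftrightarrow> (1::nat) < 2) \<and> (y1 < y3 \<longleftrightarrow> (2::nat) < 3) \<and>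
        (y3 < y1 \<longleftrightarrow> (3::nat) < 2) \<and> (y2 < y3 \<longleftrightarrow> (1::nat) < 3) \<and> (y3 < y2 \<longleftrightarrow> (3::nat) < 1) \<and>
        (x3, min y1 (min y2 y3)) \<in> cells Y"
        using * transversal_cell_iff[OF assms T, of x2 y2 x3 y3] by (auto simp: below_def)
    next
      fix x1 x2 x3 y1 y2 y3
      assume *: "x1 < x2 \<and> x2 < x3 \<and> (x1, y1) \<in> T \<and> (x2, y2) \<in> T \<and> (x3, y3) \<in> T \<and>
        (y1 < y2 \<longleftrightarrow> (2::nat) < 1) \<and> (y2 < y1 \<longleftrightarrow> (1::nat) < 2) \<and> (y1 < y3 \<longleftrightarrow> (2::nat) < 3) \<and>
        (y3 < y1 \<longleftrightarrow> (3::nat) < 2) \<and> (y2 < y3 \<longleftrightarrow> (1::nat) < 3) \<and> (y3 < y2 \<longleftrightarrow> (3::nat) < 1) \<and>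
        (x3, min y1 (min y2 y3)) \<in> cells Y"
      then have "min y1 (min y2 y3) = y2" by auto
      then show "x1 < x2 \<and> x2 < x3 \<and> (x1, y1) \<in> T \<and> (x2, y2) \<in> T \<and> (x3, y3) \<in> T \<and>
        below (column_floor Y x3) y3 y2 \<and> below (column_floor Y x3) y3 y1 \<and> \<not> y2 > y1"
        using * transversal_cell_iff[OF assms T, of x2 y2 x3 y3] by (auto simp: below_def)
    qed
  qed
  also have "{ys. distinct ys \<and> set ys = {1..length Y} \<and> sweep below (>) (floors Y) ys} =
      descending.words [] (Suc (length Y)) (floors Y)"
    by (simp add: descending.words_def atLeastLessThanSuc_atLeastAtMost)
  also have "card \<dots> = block_count (\<lambda>b. 0) [] (Suc (length Y)) (floors Y)"
    using descending.card_words[of "Suc (length Y)" "[]" "floors Y"] floors_range[OF assms]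
    by (simp add: decreasing_blocks_def length_floors)
  finally show ?thesis .
qed

lemma contains_321_iff:
  assumes "proper Y" "T \<in> transversals Y"
  shows "contains_in Y T [3, 2, 1] \<longleftrightarrow>
      (\<exists>x1 x2 x3 y1 y2 y3. x1 < x2 \<and> x2 < x3 \<and> (x1, y1) \<in> T \<and> (x2, y2) \<in> T \<and> (x3, y3) \<in> T \<and>
        y3 < y2 \<and> y2 < y1)"
  unfolding contains_in_3
proof (intro ex_cong1)
  fix x1 x2 x3 y1 y2 y3 :: nat
  have "min y1 (min y2 y3) = y3" if "y3 < y2" "y2 < y1" using that by linarith
  then show "(x1 < x2 \<and> x2 < x3 \<and> (x1, y1) \<in> T \<and> (x2, y2) \<in> T \<and> (x3, y3) \<in> T \<and>
        (y1 < y2 \<longleftrightarrow> (3::nat) < 2) \<and> (y2 < y1 \<longleftrightarrow> (2::nat) < 3) \<and> (y1 < y3 \<longleftrightarrow> (3::nat) < 1) \<and>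
        (y3 < y1 \<longleftrightarrow> (1::nat) < 3) \<and> (y2 < y3 \<longleftrightarrow> (2::nat) < 1) \<and> (y3 < y2 \<longleftrightarrow> (1::nat) < 2) \<and>
        (x3, min y1 (min y2 y3)) \<in> cells Y) \<longleftrightarrow>
      (x1 < x2 \<and> x2 < x3 \<and> (x1, y1) \<in> T \<and> (x2, y2) \<in> T \<and> (x3, y3) \<in> T \<and> y3 < y2 \<and> y2 < y1)"
    using transversalsD(1)[OF assms(2,1), of x3 y3] by auto
qed

lemma card_avoiders_321:
  assumes "proper Y"
  shows "card (avoiders Y [3, 2, 1]) = chain_count 0 0 (Suc (length Y)) (floors Y)"
proof -
  have "card (avoiders Y [3, 2, 1]) =
      card {ys. distinct ys \<and> set ys = {1..length Y} \<and> sweep above (>) (floors Y) ys}"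
  proof (rule card_avoiders_eq_sweep[OF assms])
    fix T assume T: "T \<in> transversals Y"
    show "contains_in Y T [3, 2, 1] \<longleftrightarrow>
      (\<exists>x1 x2 x3 y1 y2 y3. x1 < x2 \<and> x2 < x3 \<and> (x1, y1) \<in> T \<and> (x2, y2) \<in> T \<and> (x3, y3) \<in> T \<and>
        above (column_floor Y x3) y3 y2 \<and> above (column_floor Y x3) y3 y1 \<and> \<not> y2 > y1)"
      unfolding contains_321_iff[OF assms T]
    proof (intro ex_cong1)
      fix x1 x2 x3 y1 y2 y3
      have "y1 \<noteq> y2" if "x1 < x2" "(x1, y1) \<in> T" "(x2, y2) \<in> T"
        using transversalsD(3)[OF T assms, of x1 y1 x2] that by auto
      then show "(x1 < x2 \<and> x2 < x3 \<and> (x1, y1) \<in> T \<and> (x2, y2) \<in> T \<and> (x3, y3) \<in> T \<and> y3 < y2 \<and> y2 < y1) \<longleftrightarrow>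
        (x1 < x2 \<and> x2 < x3 \<and> (x1, y1) \<in> T \<and> (x2, y2) \<in> T \<and> (x3, y3) \<in> T \<and>
        above (column_floor Y x3) y3 y2 \<and> above (column_floor Y x3) y3 y1 \<and> \<not> y2 > y1)"
        by (auto simp: above_def)
    qed
  qed
  also have "{ys. distinct ys \<and> set ys = {1..length Y} \<and> sweep above (>) (floors Y) ys} =
      chain_words {} {} (Suc (length Y)) (floors Y)"
    by (simp add: chain_words_def atLeastLessThanSuc_atLeastAtMost)
  also have "card \<dots> = chain_count 0 0 (Suc (length Y)) (floors Y)"
    using card_chain_words[of "{}" "{}" "Suc (length Y)" "floors Y"] floors_range[OF assms]
    by (simp add: length_floors)
  finally show ?thesis .
qed

section \<open>Left-to-right maxima and the pattern 312\<close>

text \<open>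
  The cell \<open>q\<close> lies strictly to the upper left of the cell \<open>p\<close>.
\<close>

definition dominates :: "nat \<times> nat \<Rightarrow> nat \<times> nat \<Rightarrow> bool" where
  "dominates q p \<longleftrightarrow> fst q < fst p \<and> snd p < snd q"

text \<open>
  The left-to-right maxima: the elements with no other element to their upper left.
\<close>

definition maxima :: "(nat \<times> nat) set \<Rightarrow> (nat \<times> nat) set" where
  "maxima T = {p \<in> T. \<not> (\<exists>q\<in>T. dominates q p)}"

lemma maxima_insert_dominated:
  assumes "q \<in> R" "dominates q a" "dominates q b"
  shows "maxima (R \<union> {a, b}) = maxima R"
proof -
  have "dominates q p" if "dominates a p \<or> dominates b p" for p
    using that assms(2,3) unfolding dominates_def by (meson less_trans)
  then show ?thesis using assms unfolding maxima_def by blast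
qed

text \<open>
  A 321-avoider is determined by its left-to-right maxima, since its other elements increase from
  left to right and fill the remaining columns and rows.
\<close>

lemma avoider_321_eqI:
  assumes "proper Y" "T1 \<in> transversals Y" "T2 \<in> transversals Y"
    and avoid: "\<not> contains_in Y T1 [3, 2, 1]" "\<not> contains_in Y T2 [3, 2, 1]"
    and max: "maxima T1 = maxima T2"
  shows "T1 = T2"
proof (rule ccontr)
  assume "T1 \<noteq> T2"
  then have ex: "\<exists>x. \<exists>y. ((x, y) \<in> T1) \<noteq> ((x, y) \<in> T2)" by auto
  define x where "x = (LEAST x. \<exists>y. ((x, y) \<in> T1) \<noteq> ((x, y) \<in> T2))"
  have differ: "\<exists>y. ((x, y) \<in> T1) \<noteq> ((x, y) \<in> T2)" unfolding x_def by (rule LeastI_ex[OF ex])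
  have agree: "(x', y) \<in> T1 \<longleftrightarrow> (x', y) \<in> T2" if "x' < x" for x' y
    using not_less_Least[OF that[unfolded x_def]] by blast
  note t1 = transversalsD[OF assms(2,1)] and t2 = transversalsD[OF assms(3,1)]
  have "1 \<le> x" "x \<le> length Y" using differ t1(1) t2(1) by blast+
  then obtain y1 y2 where y: "(x, y1) \<in> T1" "(x, y2) \<in> T2" using t1(4) t2(4) by blast
  have neq: "y1 \<noteq> y2" using differ y t1(2) t2(2) by blast
  \<comment> \<open>In the transversal with the higher element in the first differing column, the row of the lower
    element is used further to the right; a larger element to the left completes a 321.\<close>
  have False
    if less: "y < y'" and S: "(x, y) \<in> S" "(x, y') \<in> S'" "S \<in> transversals Y" "S' \<in> transversals Y"
      "\<not> contains_in Y S' [3, 2, 1]" "maxima S = maxima S'"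
      "\<And>x' y. x' < x \<Longrightarrow> (x', y) \<in> S \<longleftrightarrow> (x', y) \<in> S'" for S S' y y'
  proof -
    note s = transversalsD[OF S(3) assms(1)] and s' = transversalsD[OF S(4) assms(1)]
    have "(x, y) \<notin> S'" using s'(2)[OF S(2)] less by blast
    moreover have "1 \<le> y" "y \<le> length Y" using s(1)[OF S(1)] by auto
    ultimately obtain x' where x': "(x', y) \<in> S'" "x' \<noteq> x" using s'(5) by blast
    have "x < x'"
    proof (rule ccontr)
      assume "\<not> x < x'"
      then have "x' < x" using x'(2) by simp
      then have "(x', y) \<in> S" using S(7) x'(1) by blast
      then show False using s(3)[OF S(1)] x'(2) by blast
    qed
    have "(x, y') \<notin> maxima S'"
    proof
      assume "(x, y') \<in> maxima S'"
      then have "(x, y') \<in> S" using S(6) by (auto simp: maxima_def)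
      then show False using s(2)[OF S(1)] less by blast
    qed
    then obtain x0 y0 where "(x0, y0) \<in> S'" "x0 < x" "y' < y0"
      using S(2) by (auto simp: maxima_def dominates_def)
    then show False
      using S(2,5) x'(1) \<open>x < x'\<close> less unfolding contains_321_iff[OF assms(1) S(4)] by blast
  qed
  then show False
    using neq y assms agree by (metis nat_neq_iff)
qed

text \<open>
  Exchanging the rows of an ascending pair whose lower right corner is a cell of the diagram gives
  another transversal, and it lowers the sum of the products of the coordinates.
\<close>

lemma swap_columns:
  assumes "proper Y" "T \<in> transversals Y" "(x2, y2) \<in> T" "(x3, y3) \<in> T" "x2 < x3" "y2 < y3"
    and corner: "(x3, y2) \<in> cells Y"
  defines "R \<equiv> T - {(x2, y2), (x3, y3)}"
  shows "T = R \<union> {(x2, y2), (x3, y3)}" "R \<union> {(x2, y3), (x3, y2)} \<in> transversals Y"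
    "(\<Sum>(x, y)\<in>R \<union> {(x2, y3), (x3, y2)}. x * y) < (\<Sum>(x, y)\<in>T. x * y)"
proof -
  note t = transversalsD[OF assms(2,1)]
  \<comment> \<open>The new transversal is the old one with columns \<open>x2\<close> and \<open>x3\<close> transposed.\<close>
  define s where "s = (\<lambda>x. if x = x2 then x3 else if x = x3 then x2 else x)"
  let ?T' = "R \<union> {(x2, y3), (x3, y2)}"
  show T: "T = R \<union> {(x2, y2), (x3, y3)}" using assms(3,4) by (auto simp: R_def)
  have new: "(x2, y3) \<notin> T" "(x3, y2) \<notin> T" using t(2) assms(3-6) by blast+
  have s_s: "s (s x) = x" for x by (simp add: s_def)
  have s_range: "s x \<in> {1..length Y} \<longleftrightarrow> x \<in> {1..length Y}" for x
    using t(1)[OF assms(3)] t(1)[OF assms(4)] by (auto simp: s_def)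
  have iff: "(x, y) \<in> ?T' \<longleftrightarrow> (s x, y) \<in> T" for x y
  proof -
    have "(x2, y) \<in> T \<longleftrightarrow> y = y2" "(x3, y) \<in> T \<longleftrightarrow> y = y3" using t(2) assms(3,4) by blast+
    then show ?thesis using assms(5) by (auto simp: s_def R_def)
  qed
  have "?T' \<subseteq> cells Y"
  proof -
    have "R \<subseteq> cells Y" using t(1) by (auto simp: R_def)
    moreover have "(x2, y3) \<in> cells Y"
      using cells_mono[OF assms(1), of x2 y2 x2 y3] t(1)[OF assms(3)] t(1)[OF assms(4)] assms(6) by simp
    ultimately show ?thesis using corner by simp
  qed
  moreover have "finite T"
    by (rule finite_subset[of _ "{1..length Y} \<times> {1..length Y}"]) (use t(1) in auto)
  then have fin: "finite R" by (simp add: R_def)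
  have "card ?T' = card T"
  proof -
    have "card ?T' = card R + card {(x2, y3), (x3, y2)}"
      using fin new by (intro card_Un_disjoint) (auto simp: R_def)
    also have "card {(x2, y3), (x3, y2)} = card {(x2, y2), (x3, y3)}" using assms(5) by simp
    also have "card R + \<dots> = card (R \<union> {(x2, y2), (x3, y3)})"
      using fin by (intro card_Un_disjoint[symmetric]) (auto simp: R_def)
    also have "\<dots> = card T" by (simp only: T[symmetric])
    finally show ?thesis .
  qed
  moreover have "\<exists>!y. (x, y) \<in> ?T'" if "x \<in> {1..length Y}" for x
    unfolding iff using assms(2) that s_range[of x] by (simp add: transversals_def)
  moreover have "\<exists>!x. (x, y) \<in> ?T'" if y: "y \<in> {1..length Y}" for y
  proof -
    obtain x where x: "(x, y) \<in> T" "\<And>x'. (x', y) \<in> T \<Longrightarrow> x' = x"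
      using t(3,5) y by (metis atLeastAtMost_iff)
    show ?thesis
      unfolding iff
    proof (rule ex1I[of _ "s x"])
      show "(s (s x), y) \<in> T" using x(1) by (simp only: s_s)
      fix x' assume "(s x', y) \<in> T"
      then have "s x' = x" by (rule x(2))
      then show "x' = s x" using s_s[of x'] by simp
    qed
  qed
  ultimately show "?T' \<in> transversals Y"
    using assms(2) by (simp add: transversals_def)
  obtain d where d: "x3 = x2 + Suc d" using assms(5) less_iff_Suc_add by auto
  obtain e where e: "y3 = y2 + Suc e" using assms(6) less_iff_Suc_add by auto
  have "(\<Sum>(x, y)\<in>?T'. x * y) = (\<Sum>(x, y)\<in>R. x * y) + (x2 * y3 + x3 * y2)"
    using fin new assms(5) by (subst sum.union_disjoint) (auto simp: R_def)
  also have "\<dots> < (\<Sum>(x, y)\<in>R. x * y) + (x2 * y2 + x3 * y3)"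
    unfolding d e by (simp add: algebra_simps)
  also have "\<dots> = (\<Sum>(x, y)\<in>R \<union> {(x2, y2), (x3, y3)}. x * y)"
    using fin assms(5) by (subst sum.union_disjoint) (auto simp: R_def)
  finally show "(\<Sum>(x, y)\<in>?T'. x * y) < (\<Sum>(x, y)\<in>T. x * y)" using T by simp
qed

text \<open>
  Among the transversals with given left-to-right maxima, one with the least sum of products of
  coordinates avoids 312: in an occurrence of 312, the elements 1 and 2 could be exchanged,
  and the element 3 dominates their old and new positions, so the maxima would stay the same.
\<close>

lemma exists_avoider_312_with_maxima:
  assumes "proper Y" "T \<in> transversals Y"
  shows "\<exists>T'\<in>avoiders Y [3, 1, 2]. maxima T' = maxima T"
proof -
  let ?P = "\<lambda>T'. T' \<in> transversals Y \<and> maxima T' = maxima T"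
  obtain T' where T': "?P T'" and
    least: "\<And>T''. ?P T'' \<Longrightarrow> (\<Sum>(x, y)\<in>T'. x * y) \<le> (\<Sum>(x, y)\<in>T''. x * y)"
    using ex_has_least_nat[of ?P T "\<lambda>T'. \<Sum>(x, y)\<in>T'. x * y"] assms(2) by blast
  have "\<not> contains_in Y T' [3, 1, 2]"
  proof
    assume "contains_in Y T' [3, 1, 2]"
    then obtain x1 x2 x3 y1 y2 y3 where *: "x1 < x2" "x2 < x3" "(x1, y1) \<in> T'" "(x2, y2) \<in> T'"
      "(x3, y3) \<in> T'" "y2 < y3" "y3 < y1" "(x3, min y1 (min y2 y3)) \<in> cells Y"
      unfolding contains_in_3 by auto
    then have "min y1 (min y2 y3) = y2" by linarith
    then have "(x3, y2) \<in> cells Y" using *(8) by simp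
    define R where "R = T' - {(x2, y2), (x3, y3)}"
    note swap = swap_columns[OF assms(1) conjunct1[OF T'] *(4,5,2,6) \<open>(x3, y2) \<in> cells Y\<close>, folded R_def]
    have q: "(x1, y1) \<in> R" using * by (auto simp: R_def)
    have "maxima (R \<union> {(x2, y3), (x3, y2)}) = maxima R"
      by (rule maxima_insert_dominated[OF q]) (use * in \<open>auto simp: dominates_def\<close>)
    also have "\<dots> = maxima (R \<union> {(x2, y2), (x3, y3)})"
      by (rule maxima_insert_dominated[OF q, symmetric]) (use * in \<open>auto simp: dominates_def\<close>)
    also have "\<dots> = maxima T" using swap(1) T' by simp
    finally have "?P (R \<union> {(x2, y3), (x3, y2)})" using swap(2) by simp
    then show False using least swap(3) by (metis not_le)
  qed
  then show ?thesis using T' by (auto simp: avoiders_def)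
qed

lemma card_avoiders_321_le_312:
  assumes "proper Y"
  shows "card (avoiders Y [3, 2, 1]) \<le> card (avoiders Y [3, 1, 2])"
proof -
  have "\<forall>T\<in>avoiders Y [3, 2, 1]. \<exists>T'. T' \<in> avoiders Y [3, 1, 2] \<and> maxima T' = maxima T"
    using exists_avoider_312_with_maxima[OF assms] by (auto simp: avoiders_def)
  then obtain h where h: "\<forall>T\<in>avoiders Y [3, 2, 1]. h T \<in> avoiders Y [3, 1, 2] \<and> maxima (h T) = maxima T"
    by metis
  have "inj_on h (avoiders Y [3, 2, 1])"
  proof (rule inj_onI)
    fix T1 T2 assume T: "T1 \<in> avoiders Y [3, 2, 1]" "T2 \<in> avoiders Y [3, 2, 1]" "h T1 = h T2"
    then have "maxima T1 = maxima T2" using h by metis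
    then show "T1 = T2" using T avoider_321_eqI[OF assms, of T1 T2] by (auto simp: avoiders_def)
  qed
  moreover have "h ` avoiders Y [3, 2, 1] \<subseteq> avoiders Y [3, 1, 2]" using h by blast
  moreover have "finite (avoiders Y [3, 1, 2])"
  proof (rule finite_subset)
    show "avoiders Y [3, 1, 2] \<subseteq> Pow ({1..length Y} \<times> {1..length Y})"
      using transversalsD(1)[OF _ assms] by (fastforce simp: avoiders_def)
  qed simp
  ultimately show ?thesis by (rule card_inj_on_le)
qed

section \<open>The ordering of the three patterns\<close>

theorem theorem1:
  fixes Y :: "nat list"
  assumes "proper Y"
  shows "card (avoiders Y [2, 1, 3]) \<le> card (avoiders Y [1, 2, 3]) \<and>
         card (avoiders Y [1, 2, 3]) \<le> card (avoiders Y [3, 1, 2])"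
proof
  show "card (avoiders Y [2, 1, 3]) \<le> card (avoiders Y [1, 2, 3])"
    unfolding card_avoiders_213[OF assms] card_avoiders_123[OF assms] by (rule block_count_le)
  have "card (avoiders Y [1, 2, 3]) = card (avoiders Y [3, 2, 1])"
    unfolding card_avoiders_123[OF assms] card_avoiders_321[OF assms]
    by (rule block_count_eq_chain_count)
  also have "\<dots> \<le> card (avoiders Y [3, 1, 2])" by (rule card_avoiders_321_le_312[OF assms])
  finally show "card (avoiders Y [1, 2, 3]) \<le> card (avoiders Y [3, 1, 2])" .
qed

end
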